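(* Suppose $\Lambda=\{\lambda_n\}_{n\ge1}$ is a sequence in $\mathbb{D}$ and $\Theta$ is a nonconstant inner function such that $\kappa_m:=\sup_{n\ge m}|\Theta(\lambda_n)|\to0$ as $m\to\infty$. For $N>1$, let $$\sigma_N=\sum_{k\ge N}\left\|K_{\lambda_k}^\Theta\right\|^{-2}\delta_{\lambda_k}=\sum_{k\ge N}\frac{1-|\lambda_k|^2}{1-|\Theta(\lambda_k)|^2}\,\delta_{\lambda_k}.$$ Then the following are equivalent: (1) $\Lambda$ is a thin sequence; (2) $\mathcal{C}_\Theta(\sigma_N)\to1$ as $N\to\infty$; (3) $\mathcal{R}_\Theta(\sigma_N)\to1$ as $N\to\infty$.
   Context: $\mathbb{D}$ is the open unit disc, $H^2$ the Hardy space on $\mathbb{D}$ with norm $\|\cdot\|_2$, and $K_\Theta=H^2\ominus\Theta H^2$ the model space of the inner function $\Theta$, with the $H^2$ norm. Its reproducing kernel at $\lambda\in\mathbb{D}$ is $K_\lambda^\Theta(z)=\frac{1-\overline{\Theta(\lambda)}\Theta(z)}{1-\overline{\lambda}z}$, and the normalized reproducing kernel is $k_\lambda^\Theta=\sqrt{\frac{1-|\lambda|^2}{1-|\Theta(\lambda)|^2}}\,K^\Theta_\lambda$. The symbol $\delta_{\lambda_k}$ denotes the unit point mass at $\lambda_k$. A sequence $\{\lambda_j\}\subset\mathbb{D}$ is thin if $\lim_{j\to\infty}\prod_{k\ne j}\left|\frac{\lambda_j-\lambda_k}{1-\overline{\lambda_k}\lambda_j}\right|=1$. For a positive measure $\mu$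 on $\mathbb{D}$, define the (possibly infinite) constants $$\mathcal{C}_\Theta(\mu)=\sup_{f\in K_\Theta,\,f\ne0}\frac{\|f\|^2_{L^2(\mathbb{D},\mu)}}{\|f\|_2^2},\qquad\mathcal{R}_\Theta(\mu)=\sup_{z\in\mathbb{D}}\|k_z^\Theta\|^2_{L^2(\mathbb{D},\mu)}.$$ *)

theory Defs
  imports "HOL-Complex_Analysis.Complex_Analysis"
begin

text \<open>
  The disc is \<open>ball 0 1 :: complex set\<close>. A function on the disc is a total function
  \<open>complex \<Rightarrow> complex\<close> whose values off the disc are irrelevant to everything below.
\<close>

definition hardy_mean :: "(complex \<Rightarrow> complex) \<Rightarrow> (complex \<Rightarrow> complex) \<Rightarrow> real \<Rightarrow> complex" where
  "hardy_mean f g r =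
     integral {0..2*pi} (\<lambda>t. f (of_real r * cis t) * cnj (g (of_real r * cis t))) / (2 * of_real pi)"

definition hardy_sq_mean :: "(complex \<Rightarrow> complex) \<Rightarrow> real \<Rightarrow> real" where
  "hardy_sq_mean f r = integral {0..2*pi} (\<lambda>t. (norm (f (of_real r * cis t)))\<^sup>2) / (2 * pi)"

definition hardy2 :: "(complex \<Rightarrow> complex) set" where
  "hardy2 = {f. f holomorphic_on ball 0 1 \<and> bdd_above (hardy_sq_mean f ` {0..<1})}"

definition hardy_norm :: "(complex \<Rightarrow> complex) \<Rightarrow> real" where
  "hardy_norm f = sqrt (SUP r\<in>{0..<1}. hardy_sq_mean f r)"

text \<open>
  The limit exists for \<open>f, g \<in> hardy2\<close>; it is the inner product inducing \<open>hardy_norm\<close>, and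
  agrees with the \<open>L\<^sup>2\<close> inner product of the boundary functions on the circle.
\<close>

definition hardy_inner :: "(complex \<Rightarrow> complex) \<Rightarrow> (complex \<Rightarrow> complex) \<Rightarrow> complex" where
  "hardy_inner f g = Lim (at_left 1) (hardy_mean f g)"

definition inner_function :: "(complex \<Rightarrow> complex) \<Rightarrow> bool" where
  "inner_function \<Theta> \<longleftrightarrow>
     \<Theta> holomorphic_on ball 0 1 \<and> (\<forall>z\<in>ball 0 1. norm (\<Theta> z) \<le> 1) \<and>
     (AE t\<in>{0..2*pi} in lborel.
        \<exists>l. norm l = 1 \<and> ((\<lambda>r. \<Theta> (of_real r * cis t)) \<longlongrightarrow> l) (at_left 1))"

definition model_space :: "(complex \<Rightarrow> complex) \<Rightarrow> (complex \<Rightarrow> complex) set" where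
  "model_space \<Theta> =
     {f \<in> hardy2. \<forall>h \<in> (\<lambda>g z. \<Theta> z * g z) ` hardy2. hardy_inner f h = 0}"

definition model_kernel :: "(complex \<Rightarrow> complex) \<Rightarrow> complex \<Rightarrow> complex \<Rightarrow> complex" where
  "model_kernel \<Theta> w z = (1 - cnj (\<Theta> w) * \<Theta> z) / (1 - cnj w * z)"

definition normalized_model_kernel :: "(complex \<Rightarrow> complex) \<Rightarrow> complex \<Rightarrow> complex \<Rightarrow> complex" where
  "normalized_model_kernel \<Theta> w z =
     of_real (sqrt ((1 - (norm w)\<^sup>2) / (1 - (norm (\<Theta> w))\<^sup>2))) * model_kernel \<Theta> w z"

text \<open>
  Sequences in the disc are indexed by \<open>n \<ge> 1\<close>; the value at 0 is ignored. The infinite product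
  is the limit of its partial products. As all factors lie in \<open>[0, 1]\<close> this limit exists; it may
  be 0, in which case \<open>prodinf\<close> would in general be undefined.
\<close>

definition thin_sequence :: "(nat \<Rightarrow> complex) \<Rightarrow> bool" where
  "thin_sequence a \<longleftrightarrow>
     (\<forall>n\<ge>1. a n \<in> ball 0 1) \<and>
     (\<lambda>j. lim (\<lambda>n. \<Prod>k\<in>{1..n} - {j}. norm ((a j - a k) / (1 - cnj (a k) * a j)))) \<longlonglongrightarrow> 1"

definition l2_norm_sq :: "complex measure \<Rightarrow> (complex \<Rightarrow> complex) \<Rightarrow> ennreal" where
  "l2_norm_sq \<mu> f = (\<integral>\<^sup>+ z. ennreal ((norm (f z))\<^sup>2) \<partial>\<mu>)"

definition carleson_const :: "(complex \<Rightarrow> complex) \<Rightarrow> complex measure \<Rightarrow> ennreal" where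
  "carleson_const \<Theta> \<mu> =
     (SUP f\<in>{f \<in> model_space \<Theta>. \<exists>z\<in>ball 0 1. f z \<noteq> 0}.
        l2_norm_sq \<mu> f / ennreal ((hardy_norm f)\<^sup>2))"

definition reproducing_const :: "(complex \<Rightarrow> complex) \<Rightarrow> complex measure \<Rightarrow> ennreal" where
  "reproducing_const \<Theta> \<mu> = (SUP z\<in>ball 0 1. l2_norm_sq \<mu> (normalized_model_kernel \<Theta> z))"

text \<open>
  The measure \<open>\<Sum>k\<ge>N. c k \<cdot> \<delta>\<^sub>a\<^sub>k\<close> on the Borel sets of the disc, as the image under \<open>a\<close> of
  the counting measure on \<open>{N..}\<close> weighted by \<open>c\<close>; see \<open>emeasure_point_masses\<close>.
\<close>

definition point_masses :: "(nat \<Rightarrow> real) \<Rightarrow> (nat \<Rightarrow> complex) \<Rightarrow> nat \<Rightarrow> complex measure" where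
  "point_masses c a N =
     distr (density (count_space {N..}) (\<lambda>k. ennreal (c k))) (restrict_space borel (ball 0 1)) a"

lemma emeasure_point_masses:
  assumes "\<And>k. k \<ge> N \<Longrightarrow> a k \<in> ball 0 1" and "A \<in> sets (restrict_space borel (ball 0 1))"
  shows "emeasure (point_masses c a N) A =
    (\<Sum>i. ennreal (c (i + N)) * indicator A (a (i + N)))"
proof -
  have m: "a \<in> measurable (density (count_space {N..}) (\<lambda>k. ennreal (c k)))
              (restrict_space borel (ball 0 1))"
    using assms(1) by (auto simp: measurable_def space_restrict_space)
  have b: "bij_betw (\<lambda>i. i + N) UNIV {N..}"
    by (rule bij_betwI[where g = "\<lambda>k. k - N"]) auto
  have "emeasure (point_masses c a N) A =
      (\<integral>\<^sup>+ k. ennreal (c k) * indicator (a -` A) k \<partial>count_space {N..})"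
    unfolding point_masses_def using m assms(2)
    by (subst emeasure_distr)
       (auto simp: emeasure_density intro!: nn_integral_cong split: split_indicator)
  also have "\<dots> = (\<integral>\<^sup>+ i. ennreal (c (i + N)) * indicator (a -` A) (i + N) \<partial>count_space UNIV)"
    by (rule nn_integral_bij_count_space[OF b, symmetric])
  also have "\<dots> = (\<Sum>i. ennreal (c (i + N)) * indicator (a -` A) (i + N))"
    by (rule nn_integral_count_space_nat)
  finally show ?thesis
    by (simp add: indicator_def)
qed

definition sigma_measure :: "(complex \<Rightarrow> complex) \<Rightarrow> (nat \<Rightarrow> complex) \<Rightarrow> nat \<Rightarrow> complex measure" where
  "sigma_measure \<Theta> a = point_masses (\<lambda>k. 1 / (hardy_norm (model_kernel \<Theta> (a k)))\<^sup>2) a"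

end

theory Submission imports Defs
begin

text \<open>
  Write $w_k = \sqrt{1-|\lambda_k|^2}$ and let $\rho$ be the pseudohyperbolic distance. Then
  $1-\rho(\lambda_j,\lambda_k)^2 = w_j^2 w_k^2/|1-\overline{\lambda_j}\lambda_k|^2$ is the squared
  modulus of the inner product of two normalised Szego kernels.
  
  The chain (2) $\Rightarrow$ (3) $\Rightarrow$ (1) comes from testing on kernels. The kernels
  $K^\Theta_z$ lie in the model space, and their norms are known because $|\Theta|=1$ almost
  everywhere on the circle, so the reproducing constant is at most the Carleson constant; a kernel
  at a point of the sequence shows that both are at least 1. Taking $z = \lambda_n$ in
  (3) makes $\sum_{k \ge N, k \ne n} (1-\rho(\lambda_k,\lambda_n)^2)$ small uniformly in
  $n \ge N$. This bounds the part $k \ge N$ of the thinness product from below, and it forces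
  $|\lambda_n| \to 1$, which takes care of the finitely many factors with $k < N$.
  
  For (1) $\Rightarrow$ (2), the model space is a subspace of $H^2$ and the weights of $\sigma_N$
  differ from $w_k^2$ by a factor between 1 and $1/(1-\kappa_N^2)$. It is therefore enough that
  $\sum_{k\ge N} w_k^2|f(\lambda_k)|^2 \le (1+o(1))\|f\|^2$ on $H^2$, that is, that the Gram matrix
  $G$ of the normalised Szego kernels at the points of a finite part of a tail has norm at most
  $1+o(1)$. Two facts about $G$ combine to give this.
  
  \<^item> The real part of $G$ is close to the identity. Up to a small term it is one half of a Gram
    matrix of Poisson kernels, whose entries are positive, and the off-diagonal part is controlled
    by the Vinogradov--Senichkin test (\<open>vinogradov_senichkin\<close>, \<open>szego_gram_add_cnj_le\<close>). The
    imaginary part resembles a discrete Hilbert transform, which cannot be bounded by absolute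
    values.
  
  \<^item> $G^{-1}$ is $D\,\overline{G}\,D^*$ for a diagonal matrix $D$ whose entries have modulus
    $1/|B_j(\lambda_j)|$, where $B_j$ is the Blaschke product over the other points. On the circle
    this is the conjugation $f \mapsto B\overline{zf}$ (\<open>szego_companion\<close>).
  
  If $t$ is the smallest eigenvalue of $G$ and $G+\overline{G} \le 2c$, then the largest eigenvalue of
  $\overline{G}$ is at most $2c-t$, and the second fact turns this into
  $1/t \le (2c-t)/\delta$ with $\delta = \min_j |B_j(\lambda_j)|^2$. As $c$ and $\delta$ tend to 1,
  the inequality $t(2c-t) \ge \delta$ forces $t \to 1$ and hence $\|G\| \le 2c-t \to 1$
  (\<open>szego_gram_le\<close>). The constant is uniform over finite parts, so it passes to the whole tail.
\<close>

section \<open>Pseudohyperbolic geometry\<close>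

lemma one_minus_pseudohyperbolic_sq:
  fixes u v :: complex
  assumes "norm u < 1" "norm v < 1"
  shows "1 - (norm ((u - v) / (1 - cnj v * u)))\<^sup>2
       = (1 - (norm u)\<^sup>2) * (1 - (norm v)\<^sup>2) / (norm (1 - cnj v * u))\<^sup>2"
proof -
  have "norm (cnj v * u) \<le> norm u" using assms by (simp add: norm_mult mult_left_le_one_le)
  hence "norm (cnj v * u) < 1" using assms by simp
  hence nz: "1 - cnj v * u \<noteq> 0" by auto
  have "complex_of_real ((norm (1 - cnj v * u))\<^sup>2 - (norm (u - v))\<^sup>2) = of_real ((1 - (norm u)\<^sup>2) * (1 - (norm v)\<^sup>2))"
    by (simp add: complex_norm_square algebra_simps flip: of_real_power)
  hence "(norm (1 - cnj v * u))\<^sup>2 - (norm (u - v))\<^sup>2 = (1 - (norm u)\<^sup>2) * (1 - (norm v)\<^sup>2)"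
    using of_real_eq_iff by blast
  thus ?thesis using nz by (simp add: norm_divide power_divide field_simps)
qed

lemma norm_one_minus_cnj_mult_commute: "norm (1 - cnj v * u) = norm (1 - cnj u * v)"
proof -
  have "1 - cnj v * u = cnj (1 - cnj u * v)" by simp
  thus ?thesis by (metis complex_mod_cnj)
qed

lemma norm_one_minus_cnj_mult_ge:
  assumes "norm u < 1" "norm v < 1"
  shows "1 - norm u \<le> norm (1 - cnj v * u)"
proof -
  have "norm (cnj v * u) \<le> norm u" using assms by (simp add: norm_mult mult_left_le_one_le)
  thus ?thesis using norm_triangle_ineq2[of 1 "cnj v * u"] by simp
qed

lemma norm_diff_le_norm_one_minus_cnj_mult:
  assumes "norm u < 1" "norm v < 1"
  shows "norm (u - v) \<le> norm (1 - cnj v * u)"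
proof -
  have pos: "0 < norm (1 - cnj v * u)"
    using norm_one_minus_cnj_mult_ge[OF assms] assms by linarith
  have "0 \<le> 1 - (norm ((u - v) / (1 - cnj v * u)))\<^sup>2"
    unfolding one_minus_pseudohyperbolic_sq[OF assms]
    using assms by (auto intro!: divide_nonneg_nonneg mult_nonneg_nonneg simp: power_le_one)
  hence "norm ((u - v) / (1 - cnj v * u)) \<le> 1" by (simp add: power2_le_iff_abs_le abs_square_le_1)
  thus ?thesis using pos by (simp add: norm_divide field_simps)
qed

text \<open>
  The quantity $|1-\overline{u}v|$ is comparable to a boundary distance enlarged by the depth of the
  points, which is why it obeys the triangle inequality up to a constant.
\<close>

lemma norm_one_minus_cnj_mult_quasi_triangle:
  assumes "norm u < 1" "norm v < 1" "norm z < 1"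
  shows "norm (1 - cnj u * v) \<le> 3 * (norm (1 - cnj u * z) + norm (1 - cnj z * v))"
proof -
  have "1 - cnj u * v = of_real (1 - (norm u)\<^sup>2) + cnj u * (u - v)"
    by (simp add: algebra_simps complex_norm_square flip: of_real_power)
  hence "norm (1 - cnj u * v) \<le> norm (complex_of_real (1 - (norm u)\<^sup>2)) + norm (cnj u * (u - v))"
    by (metis norm_triangle_ineq)
  also have "norm (complex_of_real (1 - (norm u)\<^sup>2)) = 1 - (norm u)\<^sup>2"
    using assms by (simp only: norm_of_real) (simp add: power_le_one)
  also have "1 - (norm u)\<^sup>2 \<le> 2 * (1 - norm u)"
  proof -
    have "0 \<le> (1 - norm u)\<^sup>2" by simp
    thus ?thesis by (simp add: power2_eq_square algebra_simps)
  qed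
  also have "norm (cnj u * (u - v)) \<le> norm (u - v)"
    using assms by (simp add: norm_mult mult_left_le_one_le)
  also have "norm (u - v) \<le> norm (u - z) + norm (z - v)"
    using norm_triangle_ineq[of "u - z" "z - v"] by simp
  finally have "norm (1 - cnj u * v) \<le> 2 * (1 - norm u) + norm (u - z) + norm (z - v)" by simp
  moreover have "1 - norm u \<le> norm (1 - cnj u * z)"
    using norm_one_minus_cnj_mult_ge[OF assms(1,3)] by (simp add: norm_one_minus_cnj_mult_commute)
  moreover have "norm (u - z) \<le> norm (1 - cnj u * z)"
    using norm_diff_le_norm_one_minus_cnj_mult[OF assms(1,3)] by (simp add: norm_one_minus_cnj_mult_commute)
  moreover have "norm (z - v) \<le> norm (1 - cnj z * v)"
    using norm_diff_le_norm_one_minus_cnj_mult[OF assms(3,2)] by (simp add: norm_one_minus_cnj_mult_commute)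
  ultimately show ?thesis using norm_ge_zero[of "1 - cnj z * v"] by argo
qed

section \<open>The Vinogradov--Senichkin test\<close>

text \<open>
  The row sums of $T$ need not be small, so they give no bound directly. Instead $T T^*$ is compared
  entrywise with $T$ itself: in the entry $(i,l)$ every $j$ is far from $i$ or far from $l$ in the
  quasi-metric $d$, so one of the two kernels can be replaced by a multiple of the kernel at $(i,l)$ and
  the other one is summed with the row bound. This yields
  $T T^* \le 4\epsilon\,\mathrm{I} + 72\epsilon\,(T + T^*)$, and a bound on $T^*x$ follows by solving a
  quadratic inequality. Restricting $T$ to pairs with $w_j \le w_i$ is what makes its entries comparable to
  those of $T T^*$.
\<close>

lemma vinogradov_senichkin:
  fixes w :: "'i \<Rightarrow> real" and d :: "'i \<Rightarrow> 'i \<Rightarrow> real" and x :: "'i \<Rightarrow> real"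
  assumes fin: "finite I"
    and wpos: "\<And>i. i \<in> I \<Longrightarrow> 0 < w i"
    and dpos: "\<And>i j. i \<in> I \<Longrightarrow> j \<in> I \<Longrightarrow> 0 < d i j"
    and dsym: "\<And>i j. d i j = d j i"
    and dtri: "\<And>i j l. i \<in> I \<Longrightarrow> j \<in> I \<Longrightarrow> l \<in> I \<Longrightarrow> d i l \<le> 3 * (d i j + d j l)"
    and wd: "\<And>i j. i \<in> I \<Longrightarrow> j \<in> I \<Longrightarrow> (w i)\<^sup>2 \<le> 2 * d i j"
    and rows: "\<And>i. i \<in> I \<Longrightarrow> (\<Sum>j\<in>I-{i}. (w i)\<^sup>2 * (w j)\<^sup>2 / (d i j)\<^sup>2) \<le> \<epsilon>"
    and xpos: "\<And>i. i \<in> I \<Longrightarrow> 0 \<le> x i"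
    and T_def: "\<And>i j. T i j = (if i \<noteq> j \<and> w j \<le> w i then (w i)^3 * w j / (d i j)\<^sup>2 else 0)"
  shows "(\<Sum>i\<in>I. \<Sum>j\<in>I. T i j * x i * x j)
       \<le> (72 * \<epsilon> + sqrt (4 * \<epsilon> + (72 * \<epsilon>)\<^sup>2)) * (\<Sum>i\<in>I. (x i)\<^sup>2)"
proof (cases "I = {}")
  case False
  then obtain i0 where "i0 \<in> I" by auto
  have "0 \<le> (\<Sum>j\<in>I-{i0}. (w i0)\<^sup>2 * (w j)\<^sup>2 / (d i0 j)\<^sup>2)" by (intro sum_nonneg) auto
  hence e0: "0 \<le> \<epsilon>" using rows[OF \<open>i0 \<in> I\<close>] by simp
  have T0: "0 \<le> T i j" if "i \<in> I" "j \<in> I" for i j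
    using wpos[OF that(1)] wpos[OF that(2)] by (auto simp: T_def)
  have diag: "(\<Sum>j\<in>I. T i j * T i j) \<le> 4 * \<epsilon>" if i: "i \<in> I" for i
  proof -
    have "(\<Sum>j\<in>I. T i j * T i j) = (\<Sum>j\<in>I-{i}. T i j * T i j)"
      using i fin by (subst sum.remove[of _ i]) (auto simp: T_def)
    also have "\<dots> \<le> (\<Sum>j\<in>I-{i}. 4 * ((w i)\<^sup>2 * (w j)\<^sup>2 / (d i j)\<^sup>2))"
    proof (rule sum_mono)
      fix j assume j: "j \<in> I - {i}"
      have d: "0 < d i j" and wi: "0 < w i" and wj: "0 < w j" using dpos wpos i j by auto
      have "((w i)\<^sup>2)\<^sup>2 \<le> (2 * d i j)\<^sup>2" using wd[OF i] j by (intro power_mono) auto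
      hence *: "((w i)\<^sup>2)\<^sup>2 / (d i j)\<^sup>2 \<le> 4" using d by (simp add: field_simps power2_eq_square)
      have "T i j * T i j \<le> ((w i)^3 * w j / (d i j)\<^sup>2)\<^sup>2"
        using wi wj by (auto simp: T_def power2_eq_square)
      also have "\<dots> = ((w i)\<^sup>2)\<^sup>2 / (d i j)\<^sup>2 * ((w i)\<^sup>2 * (w j)\<^sup>2 / (d i j)\<^sup>2)"
        using d by (simp add: field_simps power2_eq_square power3_eq_cube)
      also have "\<dots> \<le> 4 * ((w i)\<^sup>2 * (w j)\<^sup>2 / (d i j)\<^sup>2)"
        using * by (rule mult_right_mono) simp
      finally show "T i j * T i j \<le> 4 * ((w i)\<^sup>2 * (w j)\<^sup>2 / (d i j)\<^sup>2)" .
    qed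
    also have "\<dots> \<le> 4 * \<epsilon>"
      unfolding sum_distrib_left[symmetric] using rows[OF i] by simp
    finally show ?thesis .
  qed
  have off_aux: "(\<Sum>j\<in>I. T i j * T l j) \<le> 72 * \<epsilon> * T i l"
    if i: "i \<in> I" and l: "l \<in> I" and il: "i \<noteq> l" and le: "w l \<le> w i" for i l
  proof -
    have d: "0 < d i l" and wi: "0 < w i" and wl: "0 < w l" using dpos wpos i l by auto
    define C where "C = 36 * (w i)^3 * (w l)^3 / (d i l)\<^sup>2"
    have C0: "0 \<le> C" using wi wl by (simp add: C_def)
    have "(\<Sum>j\<in>I. T i j * T l j) \<le> (\<Sum>j\<in>I. C * ((if j = l then 0 else (w j)\<^sup>2 / (d l j)\<^sup>2) + (if j = i then 0 else (w j)\<^sup>2 / (d i j)\<^sup>2)))"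
    proof (rule sum_mono)
      fix j assume j: "j \<in> I"
      show "T i j * T l j \<le> C * ((if j = l then 0 else (w j)\<^sup>2 / (d l j)\<^sup>2) + (if j = i then 0 else (w j)\<^sup>2 / (d i j)\<^sup>2))"
      proof (cases "j = i \<or> j = l")
        case True
        hence "T i j * T l j = 0" by (auto simp: T_def)
        moreover have "0 \<le> C * ((if j = l then 0 else (w j)\<^sup>2 / (d l j)\<^sup>2) + (if j = i then 0 else (w j)\<^sup>2 / (d i j)\<^sup>2))"
          using C0 by (intro mult_nonneg_nonneg add_nonneg_nonneg) auto
        ultimately show ?thesis by linarith
      next
        case False
        have dij: "0 < d i j" and dlj: "0 < d l j" and wj: "0 < w j" using dpos wpos i l j by auto
        have key: "1 / ((d i j)\<^sup>2 * (d l j)\<^sup>2) \<le> 36 / (d i l)\<^sup>2 * (1 / (d l j)\<^sup>2 + 1 / (d i j)\<^sup>2)"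
        proof (cases "d i l \<le> 6 * d i j")
          case True
          hence "(d i l)\<^sup>2 \<le> (6 * d i j)\<^sup>2" using d by (intro power_mono) auto
          hence "1 / (d i j)\<^sup>2 \<le> 36 / (d i l)\<^sup>2" using d dij by (simp add: field_simps power2_eq_square)
          hence "1 / (d i j)\<^sup>2 * (1 / (d l j)\<^sup>2) \<le> 36 / (d i l)\<^sup>2 * (1 / (d l j)\<^sup>2)"
            by (rule mult_right_mono) simp
          also have "\<dots> \<le> 36 / (d i l)\<^sup>2 * (1 / (d l j)\<^sup>2 + 1 / (d i j)\<^sup>2)"
            by (rule mult_left_mono) auto
          finally show ?thesis by simp
        next
          case F: False
          hence "d i l \<le> 6 * d l j" using dtri[OF i j l] dsym[of j l] by simp
          hence "(d i l)\<^sup>2 \<le> (6 * d l j)\<^sup>2" using d by (intro power_mono) auto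
          hence "1 / (d l j)\<^sup>2 \<le> 36 / (d i l)\<^sup>2" using d dlj by (simp add: field_simps power2_eq_square)
          hence "1 / (d l j)\<^sup>2 * (1 / (d i j)\<^sup>2) \<le> 36 / (d i l)\<^sup>2 * (1 / (d i j)\<^sup>2)"
            by (rule mult_right_mono) simp
          also have "\<dots> \<le> 36 / (d i l)\<^sup>2 * (1 / (d l j)\<^sup>2 + 1 / (d i j)\<^sup>2)"
            by (rule mult_left_mono) auto
          finally show ?thesis by (simp add: mult.commute)
        qed
        have "T i j * T l j \<le> ((w i)^3 * w j / (d i j)\<^sup>2) * ((w l)^3 * w j / (d l j)\<^sup>2)"
          using wi wj wl by (auto simp: T_def)
        also have "\<dots> = ((w i)^3 * (w l)^3 * (w j)\<^sup>2) * (1 / ((d i j)\<^sup>2 * (d l j)\<^sup>2))"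
          by (simp add: power2_eq_square)
        also have "\<dots> \<le> ((w i)^3 * (w l)^3 * (w j)\<^sup>2) * (36 / (d i l)\<^sup>2 * (1 / (d l j)\<^sup>2 + 1 / (d i j)\<^sup>2))"
          using key by (rule mult_left_mono) (use wi wj wl in auto)
        also have "\<dots> = C * ((w j)\<^sup>2 / (d l j)\<^sup>2 + (w j)\<^sup>2 / (d i j)\<^sup>2)"
          by (simp add: C_def algebra_simps add_divide_distrib)
        finally show ?thesis using False by simp
      qed
    qed
    also have "\<dots> = C * ((\<Sum>j\<in>I-{l}. (w j)\<^sup>2 / (d l j)\<^sup>2) + (\<Sum>j\<in>I-{i}. (w j)\<^sup>2 / (d i j)\<^sup>2))"
    proof -
      have "(\<Sum>j\<in>I. (if j = l then 0 else (w j)\<^sup>2 / (d l j)\<^sup>2)) = (\<Sum>j\<in>I-{l}. (w j)\<^sup>2 / (d l j)\<^sup>2)" for l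
        using fin by (intro sum.mono_neutral_cong_right) auto
      thus ?thesis by (simp add: sum.distrib flip: sum_distrib_left)
    qed
    also have "\<dots> \<le> C * (\<epsilon> / (w l)\<^sup>2 + \<epsilon> / (w i)\<^sup>2)"
    proof -
      have "(\<Sum>j\<in>I-{l}. (w j)\<^sup>2 / (d l j)\<^sup>2) \<le> \<epsilon> / (w l)\<^sup>2" if "l \<in> I" for l
      proof -
        have "(w l)\<^sup>2 * (\<Sum>j\<in>I-{l}. (w j)\<^sup>2 / (d l j)\<^sup>2) \<le> \<epsilon>"
          using rows[OF that] by (simp add: sum_distrib_left)
        thus ?thesis using wpos[OF that] by (simp add: pos_le_divide_eq mult.commute)
      qed
      thus ?thesis using i l C0 by (intro mult_left_mono add_mono) auto
    qed
    also have "\<dots> = 36 * \<epsilon> / (d i l)\<^sup>2 * ((w i)^3 * w l + w i * (w l)^3)"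
      using wi wl d by (simp add: C_def field_simps power2_eq_square power3_eq_cube)
    also have "\<dots> \<le> 36 * \<epsilon> / (d i l)\<^sup>2 * ((w i)^3 * w l + (w i)^3 * w l)"
    proof -
      have "(w l)\<^sup>2 \<le> (w i)\<^sup>2" using le wl by (intro power_mono) auto
      hence "(w i * w l) * (w l)\<^sup>2 \<le> (w i * w l) * (w i)\<^sup>2" using wi wl by (intro mult_left_mono) auto
      thus ?thesis using e0 by (intro mult_left_mono) (auto simp: power2_eq_square power3_eq_cube mult_ac)
    qed
    also have "\<dots> = 72 * \<epsilon> * T i l" using il le by (simp add: T_def)
    finally show ?thesis .
  qed
  have off: "(\<Sum>j\<in>I. T i j * T l j) \<le> (if i = l then 4 * \<epsilon> else 0) + 72 * \<epsilon> * (T i l + T l i)"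
    if i: "i \<in> I" and l: "l \<in> I" for i l
  proof -
    have p: "0 \<le> \<epsilon> * T i l" "0 \<le> \<epsilon> * T l i" using e0 T0 i l by auto
    consider "i = l" | "i \<noteq> l" "w l \<le> w i" | "i \<noteq> l" "w i \<le> w l" by linarith
    thus ?thesis
    proof cases
      case 1 thus ?thesis using diag[OF i] p by (simp add: T_def)
    next
      case 2 thus ?thesis using off_aux[OF i l 2] p by (simp add: algebra_simps)
    next
      case 3 
      have "(\<Sum>j\<in>I. T i j * T l j) = (\<Sum>j\<in>I. T l j * T i j)" by (simp add: mult.commute)
      thus ?thesis using off_aux[OF l i] 3 p by (simp add: algebra_simps)
    qed
  qed
  \<comment> \<open>The vector \<open>y\<close> is the transpose of \<open>T\<close> applied to \<open>x\<close>, so \<open>Z\<close> is the form to be bounded and \<open>Z \<le> |y| |x|\<close>.\<close>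
  define X where "X = (\<Sum>i\<in>I. (x i)\<^sup>2)"
  define y where "y j = (\<Sum>i\<in>I. T i j * x i)" for j
  define Y where "Y = (\<Sum>j\<in>I. (y j)\<^sup>2)"
  define Z where "Z = (\<Sum>i\<in>I. \<Sum>j\<in>I. T i j * x i * x j)"
  have X0: "0 \<le> X" and Y0: "0 \<le> Y" unfolding X_def Y_def by (auto intro: sum_nonneg)
  have Zy: "Z = (\<Sum>j\<in>I. y j * x j)"
    unfolding Z_def y_def by (subst sum.swap) (simp add: sum_distrib_right)
  have Z_le: "Z \<le> sqrt Y * sqrt X"
  proof -
    have "Z\<^sup>2 \<le> Y * X" unfolding Zy Y_def X_def by (rule Cauchy_Schwarz_ineq_sum)
    thus ?thesis using real_le_rsqrt real_sqrt_mult by metis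
  qed
  have "Y = (\<Sum>i\<in>I. \<Sum>l\<in>I. (\<Sum>j\<in>I. T i j * T l j) * (x i * x l))"
  proof -
    have "T i j * x i * (T l j * x l) = T i j * T l j * (x i * x l)" for i j l by (simp only: mult_ac)
    hence "Y = (\<Sum>j\<in>I. \<Sum>i\<in>I. \<Sum>l\<in>I. T i j * T l j * (x i * x l))"
      unfolding Y_def y_def power2_eq_square sum_product by presburger
    also have "\<dots> = (\<Sum>i\<in>I. \<Sum>j\<in>I. \<Sum>l\<in>I. T i j * T l j * (x i * x l))" by (rule sum.swap)
    also have "\<dots> = (\<Sum>i\<in>I. \<Sum>l\<in>I. \<Sum>j\<in>I. T i j * T l j * (x i * x l))"
      by (rule sum.cong[OF refl], rule sum.swap)
    finally show ?thesis by (simp add: sum_distrib_right)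
  qed
  also have "\<dots> \<le> (\<Sum>i\<in>I. \<Sum>l\<in>I. ((if i = l then 4 * \<epsilon> else 0) + 72 * \<epsilon> * (T i l + T l i)) * (x i * x l))"
    using off xpos by (intro sum_mono mult_right_mono) auto
  also have "\<dots> = (\<Sum>i\<in>I. \<Sum>l\<in>I. (if i = l then 4 * \<epsilon> * (x i * x l) else 0))
      + 72 * \<epsilon> * (\<Sum>i\<in>I. \<Sum>l\<in>I. T i l * x i * x l) + 72 * \<epsilon> * (\<Sum>i\<in>I. \<Sum>l\<in>I. T l i * x l * x i)"
    by (simp add: sum_distrib_left flip: sum.distrib) (intro sum.cong refl, simp add: algebra_simps)
  also have "(\<Sum>i\<in>I. \<Sum>l\<in>I. (if i = l then 4 * \<epsilon> * (x i * x l) else 0)) = 4 * \<epsilon> * X"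
    using fin by (simp add: X_def sum_distrib_left power2_eq_square)
  also have "(\<Sum>i\<in>I. \<Sum>l\<in>I. T l i * x l * x i) = Z"
    unfolding Z_def by (rule sum.swap)
  also have "(\<Sum>i\<in>I. \<Sum>l\<in>I. T i l * x i * x l) = Z" by (simp add: Z_def)
  finally have Yle: "Y \<le> 4 * \<epsilon> * X + 144 * \<epsilon> * Z" by (simp add: algebra_simps)
  also have "\<dots> \<le> 4 * \<epsilon> * X + 144 * \<epsilon> * (sqrt Y * sqrt X)"
    using Z_le e0 by (intro add_left_mono mult_left_mono) auto
  finally have *: "Y \<le> 4 * \<epsilon> * X + 144 * \<epsilon> * (sqrt Y * sqrt X)" .
  define p q where "p = sqrt Y" and "q = sqrt X"
  have "p\<^sup>2 \<le> 4 * \<epsilon> * q\<^sup>2 + 144 * \<epsilon> * (p * q)" using * X0 Y0 by (simp add: p_def q_def)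
  hence "(p - 72 * \<epsilon> * q)\<^sup>2 \<le> (4 * \<epsilon> + (72 * \<epsilon>)\<^sup>2) * q\<^sup>2"
    by (simp add: power2_eq_square algebra_simps)
  hence "(sqrt Y - 72 * \<epsilon> * sqrt X)\<^sup>2 \<le> (4 * \<epsilon> + (72 * \<epsilon>)\<^sup>2) * (sqrt X)\<^sup>2"
    unfolding p_def q_def .
  hence "sqrt Y - 72 * \<epsilon> * sqrt X \<le> sqrt ((4 * \<epsilon> + (72 * \<epsilon>)\<^sup>2) * (sqrt X)\<^sup>2)"
    by (rule real_le_rsqrt)
  also have "\<dots> = sqrt (4 * \<epsilon> + (72 * \<epsilon>)\<^sup>2) * sqrt X"
    using X0 by (simp add: real_sqrt_mult)
  finally have "sqrt Y \<le> (72 * \<epsilon> + sqrt (4 * \<epsilon> + (72 * \<epsilon>)\<^sup>2)) * sqrt X" by (simp add: algebra_simps)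
  hence "sqrt Y * sqrt X \<le> (72 * \<epsilon> + sqrt (4 * \<epsilon> + (72 * \<epsilon>)\<^sup>2)) * sqrt X * sqrt X"
    using X0 by (intro mult_right_mono) auto
  also have "\<dots> = (72 * \<epsilon> + sqrt (4 * \<epsilon> + (72 * \<epsilon>)\<^sup>2)) * X"
    using X0 by (simp only: mult.assoc real_sqrt_mult_self abs_of_nonneg)
  finally show ?thesis using Z_le unfolding Z_def X_def[symmetric] by simp
qed simp

section \<open>Means over circles\<close>

lemma continuous_on_circle_param:
  assumes "continuous_on (sphere 0 r) f" "0 \<le> r"
  shows "continuous_on A (\<lambda>t. f (complex_of_real r * cis t))"
  by (rule continuous_on_compose2[OF assms(1)]) (use assms(2) in \<open>auto intro!: continuous_intros simp: norm_mult\<close>)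

lemma hardy_mean_integrable:
  assumes "continuous_on (sphere 0 r) f" "continuous_on (sphere 0 r) g" "0 \<le> r"
  shows "(\<lambda>t. f (of_real r * cis t) * cnj (g (of_real r * cis t))) integrable_on {0..2*pi}"
  by (intro integrable_continuous_interval continuous_intros continuous_on_circle_param assms)

lemma hardy_mean_cong:
  assumes "\<And>z. norm z = r \<Longrightarrow> f z * cnj (g z) = f' z * cnj (g' z)" "0 \<le> r"
  shows "hardy_mean f g r = hardy_mean f' g' r"
  unfolding hardy_mean_def by (intro arg_cong2[where f="(/)"] integral_cong refl assms) (use assms(2) in \<open>simp add: norm_mult\<close>)

lemma hardy_mean_cnj: "hardy_mean g f r = cnj (hardy_mean f g r)"
proof -
  have "cnj (integral {0..2*pi} (\<lambda>t. f (of_real r * cis t) * cnj (g (of_real r * cis t))))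
     = integral {0..2*pi} (\<lambda>t. cnj (f (of_real r * cis t) * cnj (g (of_real r * cis t))))"
    by (rule integral_cnj)
  thus ?thesis by (simp add: hardy_mean_def mult.commute)
qed

lemma hardy_mean_mult_left: "hardy_mean (\<lambda>z. c * f z) g r = c * hardy_mean f g r"
  by (simp add: hardy_mean_def mult.assoc)

lemma hardy_mean_mult_right: "hardy_mean f (\<lambda>z. c * g z) r = cnj c * hardy_mean f g r"
  by (subst hardy_mean_cnj) (simp add: hardy_mean_mult_left flip: hardy_mean_cnj)

lemma hardy_mean_sum_left:
  assumes "\<And>i. i \<in> I \<Longrightarrow> continuous_on (sphere 0 r) (f i)" "continuous_on (sphere 0 r) g" "0 \<le> r" "finite I"
  shows "hardy_mean (\<lambda>z. \<Sum>i\<in>I. f i z) g r = (\<Sum>i\<in>I. hardy_mean (f i) g r)"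
  unfolding hardy_mean_def using assms
  by (simp add: sum_distrib_right integral_sum hardy_mean_integrable flip: sum_divide_distrib)

lemma hardy_mean_sum_right:
  assumes "\<And>i. i \<in> I \<Longrightarrow> continuous_on (sphere 0 r) (f i)" "continuous_on (sphere 0 r) g" "0 \<le> r" "finite I"
  shows "hardy_mean g (\<lambda>z. \<Sum>i\<in>I. f i z) r = (\<Sum>i\<in>I. hardy_mean g (f i) r)"
  by (subst hardy_mean_cnj) (simp add: hardy_mean_sum_left assms flip: hardy_mean_cnj)

lemma hardy_mean_diff_left:
  assumes "continuous_on (sphere 0 r) f" "continuous_on (sphere 0 r) h" "continuous_on (sphere 0 r) g" "0 \<le> r"
  shows "hardy_mean (\<lambda>z. f z - h z) g r = hardy_mean f g r - hardy_mean h g r"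
  unfolding hardy_mean_def using assms
  by (simp add: left_diff_distrib integral_diff hardy_mean_integrable diff_divide_distrib)

lemma hardy_mean_diff_right:
  assumes "continuous_on (sphere 0 r) f" "continuous_on (sphere 0 r) h" "continuous_on (sphere 0 r) g" "0 \<le> r"
  shows "hardy_mean g (\<lambda>z. f z - h z) r = hardy_mean g f r - hardy_mean g h r"
  by (subst hardy_mean_cnj) (simp add: hardy_mean_diff_left assms flip: hardy_mean_cnj)

lemma hardy_mean_self:
  assumes "continuous_on (sphere 0 r) f" "0 \<le> r"
  shows "hardy_mean f f r = of_real (hardy_sq_mean f r)"
proof -
  have "((\<lambda>t. (norm (f (of_real r * cis t)))\<^sup>2) has_integral
       integral {0..2*pi} (\<lambda>t. (norm (f (of_real r * cis t)))\<^sup>2)) {0..2*pi}"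
    by (intro integrable_integral integrable_continuous_interval continuous_intros continuous_on_circle_param assms)
  hence "((\<lambda>t. complex_of_real ((norm (f (of_real r * cis t)))\<^sup>2)) has_integral
       of_real (integral {0..2*pi} (\<lambda>t. (norm (f (of_real r * cis t)))\<^sup>2))) {0..2*pi}"
    by (rule has_integral_of_real)
  hence "integral {0..2*pi} (\<lambda>t. complex_of_real ((norm (f (of_real r * cis t)))\<^sup>2)) =
       of_real (integral {0..2*pi} (\<lambda>t. (norm (f (of_real r * cis t)))\<^sup>2))"
    by (rule integral_unique)
  thus ?thesis unfolding hardy_mean_def hardy_sq_mean_def complex_norm_square by simp
qed

lemma hardy_sq_mean_integrable:
  assumes "continuous_on (sphere 0 r) f" "0 \<le> r"
  shows "(\<lambda>t. (norm (f (of_real r * cis t)))\<^sup>2) integrable_on {0..2*pi}"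
  by (intro integrable_continuous_interval continuous_intros continuous_on_circle_param assms)

lemma hardy_sq_mean_nonneg: "0 \<le> hardy_sq_mean f r"
  unfolding hardy_sq_mean_def
  by (cases "(\<lambda>t. (norm (f (of_real r * cis t)))\<^sup>2) integrable_on {0..2*pi}")
     (auto intro!: divide_nonneg_nonneg integral_nonneg simp: not_integrable_integral)

lemma hardy_sq_mean_mono:
  assumes "\<And>z. norm z = r \<Longrightarrow> norm (f z) \<le> norm (g z)"
    "continuous_on (sphere 0 r) f" "continuous_on (sphere 0 r) g" "0 \<le> r"
  shows "hardy_sq_mean f r \<le> hardy_sq_mean g r"
  unfolding hardy_sq_mean_def using assms(4)
  by (intro divide_right_mono integral_le hardy_sq_mean_integrable assms power_mono) (auto simp: norm_mult)

lemma hardy_sq_mean_cong: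
  assumes "\<And>z. norm z = r \<Longrightarrow> norm (f z) = norm (g z)" "0 \<le> r"
  shows "hardy_sq_mean f r = hardy_sq_mean g r"
  unfolding hardy_sq_mean_def using assms
  by (intro arg_cong2[where f="(/)"] integral_cong refl) (simp add: norm_mult)

lemma hardy_sq_mean_const: "hardy_sq_mean (\<lambda>_. c) r = (norm c)\<^sup>2"
  by (simp add: hardy_sq_mean_def)

lemma hardy_sq_mean_dilate: "hardy_sq_mean (\<lambda>z. f (of_real r * z)) 1 = hardy_sq_mean f r"
  by (simp add: hardy_sq_mean_def)

lemma hardy_mean_Cauchy_Schwarz:
  assumes f: "continuous_on (sphere 0 r) f" and g: "continuous_on (sphere 0 r) g" and r: "0 \<le> r"
  shows "(norm (hardy_mean f g r))\<^sup>2 \<le> hardy_sq_mean f r * hardy_sq_mean g r"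
proof -
  define M where "M = hardy_mean f g r"
  define A where "A = hardy_sq_mean f r"
  define B where "B = hardy_sq_mean g r"
  have quad: "0 \<le> A - 2 * s * (norm M)\<^sup>2 + s\<^sup>2 * (norm M)\<^sup>2 * B" for s :: real
  proof -
    define c where "c = of_real s * M"
    have cg: "continuous_on (sphere 0 r) (\<lambda>z. c * g z)" by (intro continuous_intros g)
    have cd: "continuous_on (sphere 0 r) (\<lambda>z. f z - c * g z)" by (intro continuous_intros g f)
    have "of_real (hardy_sq_mean (\<lambda>z. f z - c * g z) r) = hardy_mean (\<lambda>z. f z - c * g z) (\<lambda>z. f z - c * g z) r"
      using hardy_mean_self[OF cd r] by simp
    also have "\<dots> = of_real A - cnj c * M - c * cnj M + c * cnj c * of_real B"
      unfolding hardy_mean_diff_left[OF f cg cd r] hardy_mean_mult_left hardy_mean_diff_right[OF f cg f r] hardy_mean_diff_right[OF f cg g r]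
         hardy_mean_mult_right hardy_mean_self[OF f r] hardy_mean_self[OF g r]
        hardy_mean_cnj[of g f r] M_def[symmetric] A_def[symmetric] B_def[symmetric]
      by (simp add: algebra_simps)
    also have "\<dots> = of_real (A - 2 * s * (norm M)\<^sup>2 + s\<^sup>2 * (norm M)\<^sup>2 * B)"
      unfolding c_def by (simp add: algebra_simps complex_norm_square power2_eq_square[of s] flip: of_real_power)
    finally have "hardy_sq_mean (\<lambda>z. f z - c * g z) r = A - 2 * s * (norm M)\<^sup>2 + s\<^sup>2 * (norm M)\<^sup>2 * B"
      using of_real_eq_iff by blast
    thus ?thesis using hardy_sq_mean_nonneg by metis
  qed
  have B0: "0 \<le> B" by (simp add: B_def hardy_sq_mean_nonneg)
  show ?thesis
  proof (cases "B = 0")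
    case True
    have "M = 0"
    proof (rule ccontr)
      assume "M \<noteq> 0"
      thus False using quad[of "(A + 1) / (norm M)\<^sup>2"] True hardy_sq_mean_nonneg[of f r] by (simp add: A_def)
    qed
    thus ?thesis using True by (simp add: M_def B_def)
  next
    case False
    hence "0 < B" using B0 by simp
    thus ?thesis using quad[of "1 / B"] unfolding A_def[symmetric] B_def[symmetric] M_def[symmetric]
      by (simp add: field_simps power2_eq_square)
  qed
qed

text \<open>
  On the circle of radius $r$ one has $\overline{z} = r^2/z$, so the conjugate of the Szego kernel at
  $w$ becomes the Cauchy kernel at $r^2 w$.
\<close>

lemma hardy_mean_szego:
  assumes f: "continuous_on (cball 0 r) f" "f holomorphic_on ball 0 r" and r: "0 < r" and w: "r * norm w < 1"
  shows "hardy_mean f (\<lambda>z. 1 / (1 - cnj w * z)) r = f (of_real r ^ 2 * w)"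
proof -
  define v where "v = of_real r ^ 2 * w"
  have nv: "norm v < r" using r w by (simp add: v_def norm_mult norm_power power2_eq_square)
  hence "((\<lambda>u. f u / (u - v)) has_contour_integral (2 * of_real pi * \<i> * f v)) (circlepath 0 r)"
    by (intro Cauchy_integral_circlepath f) simp
  hence *: "((\<lambda>t. f (of_real r * cis t) / (of_real r * cis t - v) * (of_real r * cis t * \<i>)) has_integral
      (2 * of_real pi * \<i> * f v)) {0..2*pi}"
    unfolding circlepath_def by (subst (asm) has_contour_integral_part_circlepath_iff) (auto simp: mult_ac)
  have "((\<lambda>t. (- \<i>) * (f (of_real r * cis t) / (of_real r * cis t - v) * (of_real r * cis t * \<i>))) has_integral
      (- \<i>) * (2 * of_real pi * \<i> * f v)) {0..2*pi}"
    using has_integral_mult_right[OF *] .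
  also have "(\<lambda>t. (- \<i>) * (f (of_real r * cis t) / (of_real r * cis t - v) * (of_real r * cis t * \<i>)))
     = (\<lambda>t. f (of_real r * cis t) * cnj (1 / (1 - cnj w * (of_real r * cis t))))"
  proof
    fix t
    define p where "p = of_real r * cis t"
    define q where "q = 1 - w * (of_real r * cnj (cis t))"
    have "cis t * cnj (cis t) = 1" by (simp add: cis_cnj cis_mult)
    hence "v = p * (w * (of_real r * cnj (cis t)))" by (simp add: v_def p_def power2_eq_square algebra_simps)
    hence pq: "p - v = p * q" by (simp add: q_def algebra_simps)
    have p0: "p \<noteq> 0" using r by (simp add: p_def)
    have q0: "q \<noteq> 0"
    proof
      assume "q = 0"
      hence "norm (w * (of_real r * cnj (cis t))) = 1" by (simp add: q_def)
      thus False using w r by (simp add: norm_mult mult.commute)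
    qed
    have cq: "cnj (1 - cnj w * p) = q" by (simp add: p_def q_def)
    have "(- \<i>) * (f p / (p - v) * (p * \<i>)) = f p * (1 / q)" using p0 q0 by (simp add: pq field_simps)
    also have "1 / q = cnj (1 / (1 - cnj w * p))" by (simp add: cq del: complex_cnj_diff)
    finally show "(- \<i>) * (f (of_real r * cis t) / (of_real r * cis t - v) * (of_real r * cis t * \<i>)) =
      f (of_real r * cis t) * cnj (1 / (1 - cnj w * (of_real r * cis t)))" unfolding p_def .
  qed
  finally have "integral {0..2*pi} (\<lambda>t. f (of_real r * cis t) * cnj (1 / (1 - cnj w * (of_real r * cis t))))
     = (- \<i>) * (2 * of_real pi * \<i> * f v)" by (rule integral_unique)
  thus ?thesis unfolding hardy_mean_def v_def[symmetric] by simp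
qed

lemma hardy_sq_mean_rotate:
  assumes f: "continuous_on (sphere 0 r) f" and r: "0 \<le> r" and u: "norm u = 1"
  shows "hardy_sq_mean (\<lambda>z. f (u * z)) r = hardy_sq_mean f r"
proof -
  define a where "a = Arg2pi u"
  have a: "0 \<le> a" "a \<le> 2 * pi" using Arg2pi[of u] by (auto simp: a_def)
  have ua: "u = cis a" using Arg2pi_eq[of u] u by (simp add: a_def cis_conv_exp)
  define g where "g t = (norm (f (of_real r * cis t)))\<^sup>2" for t
  have g: "g integrable_on {x..y}" for x y
    unfolding g_def by (intro integrable_continuous_interval continuous_intros continuous_on_circle_param f r)
  have shift: "integral {x..y} (\<lambda>t. g (t + c)) = integral {x + c..y + c} g" for x y c
  proof -
    have "((\<lambda>t. g (1 *\<^sub>R t + c)) has_integral (integral {x + c..y + c} g /\<^sub>R 1 ^ DIM(real)))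
       (cbox ((x + c - c) /\<^sub>R 1) ((y + c - c) /\<^sub>R 1))"
      by (rule has_integral_affinity') (use g in auto)
    thus ?thesis by (simp add: integral_unique)
  qed
  have per: "g (t + 2 * pi) = g t" for t by (simp add: g_def flip: cis_mult)
  have "integral {0..2*pi} (\<lambda>t. g (t + a)) = integral {a..2*pi + a} g"
    by (simp add: shift)
  also have "\<dots> = integral {a..2*pi} g + integral {2*pi..2*pi + a} g"
    using a by (intro Henstock_Kurzweil_Integration.integral_combine[symmetric] g) auto
  also have "integral {2*pi..2*pi + a} g = integral {0..a} (\<lambda>t. g (t + 2*pi))"
    by (simp add: shift add.commute)
  also have "\<dots> = integral {0..a} g" by (simp add: per)
  also have "integral {a..2*pi} g + integral {0..a} g = integral {0..2*pi} g"
    using a by (subst add.commute, intro Henstock_Kurzweil_Integration.integral_combine g) auto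
  finally have *: "integral {0..2*pi} (\<lambda>t. g (t + a)) = integral {0..2*pi} g" .
  have "u * (of_real r * cis t) = of_real r * cis (t + a)" for t
    by (simp add: ua mult_ac flip: cis_mult)
  thus ?thesis using * unfolding hardy_sq_mean_def g_def by (simp only:)
qed

text \<open>
  The correlation $\Phi(z)$ of the functions $t \mapsto f(z e^{it})$ and $t \mapsto f(r e^{it})$ is
  holomorphic in $z$ and equals the mean of $|f|^2$ at $z = r$, while the Cauchy--Schwarz inequality
  bounds it on the circle $|z| = s$. The maximum principle then gives
  $M_r \le \sqrt{M_s M_r}$ for the means $M_r$, $M_s$ of $|f|^2$.
\<close>

lemma hardy_sq_mean_increasing:
  assumes f: "f holomorphic_on ball 0 1" and r: "0 \<le> r" "r \<le> s" "s < 1"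
  shows "hardy_sq_mean f r \<le> hardy_sq_mean f s"
proof -
  have cont: "continuous_on (sphere 0 q) f" if "q < 1" for q
    by (rule continuous_on_subset[OF holomorphic_on_imp_continuous_on[OF f]]) (use that in auto)
  define \<Psi> where "\<Psi> z = integral (cbox 0 (2*pi)) (\<lambda>t. f (z * cis t) * cnj (f (of_real r * cis t)))" for z
  have in_ball: "z * cis t \<in> ball 0 1" if "z \<in> ball 0 1" for z t using that by (simp add: norm_mult)
  have "\<Psi> holomorphic_on ball 0 1"
    unfolding \<Psi>_def
  proof (rule leibniz_rule_holomorphic[where fx = "\<lambda>z t. deriv f (z * cis t) * cis t * cnj (f (of_real r * cis t))"])
    fix z t assume z: "z \<in> ball (0::complex) 1"
    have "(f has_field_derivative deriv f (z * cis t)) (at (z * cis t))"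
      using in_ball[OF z] by (intro holomorphic_derivI[OF f]) auto
    hence "((\<lambda>z. f (z * cis t)) has_field_derivative deriv f (z * cis t) * cis t) (at z within ball 0 1)"
      by (rule DERIV_chain2) (auto intro!: derivative_eq_intros)
    thus "((\<lambda>z. f (z * cis t) * cnj (f (of_real r * cis t))) has_field_derivative
       deriv f (z * cis t) * cis t * cnj (f (of_real r * cis t))) (at z within ball 0 1)"
      by (rule DERIV_cmult_right)
  next
    fix z assume z: "z \<in> ball (0::complex) 1"
    have "continuous_on {0..2*pi} (\<lambda>t. f (z * cis t))"
      by (rule continuous_on_compose2[OF holomorphic_on_imp_continuous_on[OF f]]) (use in_ball[OF z] in \<open>auto intro!: continuous_intros\<close>)
    thus "(\<lambda>t. f (z * cis t) * cnj (f (of_real r * cis t))) integrable_on cbox 0 (2 * pi)"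
      using r unfolding cbox_interval by (intro integrable_continuous_interval continuous_intros continuous_on_circle_param cont) auto
  next
    have d: "continuous_on (ball 0 1) (deriv f)"
      by (intro holomorphic_on_imp_continuous_on holomorphic_deriv f) auto
    have "continuous_on (ball 0 1 \<times> cbox 0 (2*pi)) (\<lambda>p. deriv f (fst p * cis (snd p)))"
      by (rule continuous_on_compose2[OF d]) (auto intro!: continuous_intros simp: norm_mult)
    moreover have "continuous_on (ball (0::complex) 1 \<times> cbox 0 (2*pi)) (\<lambda>p. f (of_real r * cis (snd p)))"
      by (rule continuous_on_compose2[OF holomorphic_on_imp_continuous_on[OF f]]) (use r in \<open>auto intro!: continuous_intros simp: norm_mult\<close>)
    ultimately show "continuous_on (ball 0 1 \<times> cbox 0 (2*pi)) (\<lambda>(z, t). deriv f (z * cis t) * cis t * cnj (f (of_real r * cis t)))"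
      unfolding case_prod_unfold by (intro continuous_intros)
  qed auto
  define \<Phi> where "\<Phi> z = \<Psi> z / (2 * of_real pi)" for z
  have hol: "\<Phi> holomorphic_on ball 0 1" unfolding \<Phi>_def
    by (intro holomorphic_intros \<open>\<Psi> holomorphic_on ball 0 1\<close>) auto
  have \<Phi>r: "\<Phi> (of_real r) = of_real (hardy_sq_mean f r)"
    using r hardy_mean_self[OF cont, of r] by (simp add: \<Phi>_def \<Psi>_def hardy_mean_def)
  have "norm (\<Phi> (of_real r)) \<le> sqrt (hardy_sq_mean f s * hardy_sq_mean f r)"
  proof (rule maximum_modulus_frontier[where S = "cball 0 s" and f = \<Phi> and \<xi> = "of_real r"])
    show "\<Phi> holomorphic_on interior (cball 0 s)"
      by (rule holomorphic_on_subset[OF hol]) (use r in \<open>auto simp: interior_cball\<close>)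
    show "continuous_on (closure (cball 0 s)) \<Phi>"
      by (rule continuous_on_subset[OF holomorphic_on_imp_continuous_on[OF hol]]) (use r in auto)
    show "complex_of_real r \<in> cball 0 s" using r by simp
    fix z :: complex assume "z \<in> frontier (cball 0 s)"
    hence z: "norm z = s" by (simp add: frontier_cball)
    define u where "u = cis (Arg z)"
    have zu: "z = of_real s * u" using z by (simp add: u_def rcis_def[symmetric] rcis_cmod_Arg flip: z)
    have nu: "norm u = 1" by (simp add: u_def)
    have scale: "hardy_sq_mean (\<lambda>v. f (u * v)) s = hardy_sq_mean f s"
      by (rule hardy_sq_mean_rotate) (use cont r nu in auto)
    define h where "h v = f (u * v)" for v
    define k where "k v = f (of_real r * v)" for v
    have scale': "hardy_sq_mean (\<lambda>v. h (of_real s * v)) 1 = hardy_sq_mean f s"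
      using scale by (subst hardy_sq_mean_dilate) (simp add: h_def[abs_def])
    have kr: "hardy_sq_mean k 1 = hardy_sq_mean f r"
      by (simp add: k_def[abs_def] hardy_sq_mean_dilate)
    have "\<Phi> z = hardy_mean (\<lambda>v. h (of_real s * v)) k 1"
      by (simp add: \<Phi>_def \<Psi>_def hardy_mean_def h_def k_def zu mult_ac)
    moreover have "(norm (hardy_mean (\<lambda>v. h (of_real s * v)) k 1))\<^sup>2 \<le> hardy_sq_mean (\<lambda>v. h (of_real s * v)) 1 * hardy_sq_mean k 1"
    proof (rule hardy_mean_Cauchy_Schwarz)
      show "continuous_on (sphere 0 1) (\<lambda>v. h (of_real s * v))" unfolding h_def
        by (rule continuous_on_compose2[OF holomorphic_on_imp_continuous_on[OF f]]) (use r nu in \<open>auto intro!: continuous_intros simp: norm_mult\<close>)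
      show "continuous_on (sphere 0 1) k" unfolding k_def
        by (rule continuous_on_compose2[OF holomorphic_on_imp_continuous_on[OF f]]) (use r in \<open>auto intro!: continuous_intros simp: norm_mult\<close>)
    qed auto
    ultimately show "norm (\<Phi> z) \<le> sqrt (hardy_sq_mean f s * hardy_sq_mean f r)"
      unfolding scale' kr by (intro real_le_rsqrt) simp
  qed auto
  hence "hardy_sq_mean f r \<le> sqrt (hardy_sq_mean f s * hardy_sq_mean f r)"
    unfolding \<Phi>r using hardy_sq_mean_nonneg[of f r] by simp
  hence "(hardy_sq_mean f r)\<^sup>2 \<le> hardy_sq_mean f s * hardy_sq_mean f r"
    using hardy_sq_mean_nonneg[of f r] hardy_sq_mean_nonneg[of f s]
    by (metis mult_nonneg_nonneg real_sqrt_le_iff real_sqrt_pow2 power_mono)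
  thus ?thesis using hardy_sq_mean_nonneg[of f r] hardy_sq_mean_nonneg[of f s]
    by (cases "hardy_sq_mean f r = 0") (auto simp: power2_eq_square)
qed

section \<open>The Gram form of Szego kernels\<close>

definition unit_szego :: "complex \<Rightarrow> complex \<Rightarrow> complex" where
  "unit_szego l z = of_real (sqrt (1 - (norm l)\<^sup>2)) * (1 / (1 - cnj l * z))"

text \<open>
  The quadratic form of the Gram matrix of the normalised Szego kernels at the points $l_i$,
  defined as a norm so that positivity and the Cauchy--Schwarz inequality come for free.
\<close>

definition szego_gram :: "'i set \<Rightarrow> ('i \<Rightarrow> complex) \<Rightarrow> ('i \<Rightarrow> complex) \<Rightarrow> real" where
  "szego_gram I l x = hardy_sq_mean (\<lambda>z. \<Sum>i\<in>I. x i * unit_szego (l i) z) 1"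

lemma one_minus_cnj_mult_nonzero: "norm l < 1 \<Longrightarrow> norm z \<le> 1 \<Longrightarrow> 1 - cnj l * z \<noteq> 0"
proof
  assume "norm l < 1" "norm z \<le> 1" "1 - cnj l * z = 0"
  hence "norm (cnj l * z) = 1" by simp
  moreover have "norm (cnj l * z) \<le> norm l" using \<open>norm z \<le> 1\<close> by (simp add: norm_mult mult_left_le)
  ultimately show False using \<open>norm l < 1\<close> by simp
qed

lemma unit_szego_holomorphic: "norm l < 1 \<Longrightarrow> unit_szego l holomorphic_on cball 0 1"
  unfolding unit_szego_def by (intro holomorphic_intros) (use one_minus_cnj_mult_nonzero in auto)

lemma unit_szego_continuous:
  assumes "norm l < 1" shows "continuous_on (sphere 0 1) (unit_szego l)"
  by (rule continuous_on_subset[OF holomorphic_on_imp_continuous_on[OF unit_szego_holomorphic[OF assms]]]) auto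

lemma hardy_mean_unit_szego:
  assumes "continuous_on (cball 0 1) f" "f holomorphic_on ball 0 1" "norm l < 1"
  shows "hardy_mean f (unit_szego l) 1 = of_real (sqrt (1 - (norm l)\<^sup>2)) * f l"
  using hardy_mean_szego[OF assms(1,2), of l] assms(3)
  unfolding unit_szego_def[abs_def] hardy_mean_mult_right by simp

context
  fixes I :: "'i set" and l :: "'i \<Rightarrow> complex"
  assumes fin: "finite I" and disc: "\<And>i. i \<in> I \<Longrightarrow> norm (l i) < 1"
begin

abbreviation (input) "wt i \<equiv> sqrt (1 - (norm (l i))\<^sup>2)"

lemma w_pos: "i \<in> I \<Longrightarrow> 0 < wt i"
  using disc by (simp add: power_less_one_iff)

lemma w_sq: "i \<in> I \<Longrightarrow> (wt i)\<^sup>2 = 1 - (norm (l i))\<^sup>2"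
  using disc[of i] by (simp add: power_le_one)

lemma szego_sum_continuous: "continuous_on (sphere 0 1) (\<lambda>z. \<Sum>i\<in>I. x i * unit_szego (l i) z)"
  by (intro continuous_intros unit_szego_continuous disc)

lemma hardy_mean_szego_sum:
  assumes "continuous_on (cball 0 1) f" "f holomorphic_on ball 0 1"
  shows "hardy_mean f (\<lambda>z. \<Sum>i\<in>I. x i * unit_szego (l i) z) 1 = (\<Sum>i\<in>I. cnj (x i) * (of_real (wt i) * f (l i)))"
proof -
  have "continuous_on (sphere 0 1) f" by (rule continuous_on_subset[OF assms(1)]) auto
  thus ?thesis
    by (subst hardy_mean_sum_right)
       (auto intro!: continuous_intros unit_szego_continuous disc fin simp: hardy_mean_mult_right hardy_mean_unit_szego assms disc)
qed

lemma szego_duality: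
  assumes f: "continuous_on (cball 0 1) f" "f holomorphic_on ball 0 1"
  shows "(norm (\<Sum>i\<in>I. cnj (x i) * (of_real (wt i) * f (l i))))\<^sup>2 \<le> hardy_sq_mean f 1 * szego_gram I l x"
proof -
  have "continuous_on (sphere 0 1) f" by (rule continuous_on_subset[OF f(1)]) auto
  from hardy_mean_Cauchy_Schwarz[OF this szego_sum_continuous[of x]]
  show ?thesis unfolding hardy_mean_szego_sum[OF f] szego_gram_def by simp
qed

text \<open>
  Duality: the embedding $f \mapsto (w_i f(l_i))_i$ is the adjoint of the synthesis map
  $x \mapsto \sum_i x_i k_i$, so both have the same norm.
\<close>

lemma carleson_of_szego_gram:
  assumes f: "continuous_on (cball 0 1) f" "f holomorphic_on ball 0 1"
    and T0: "0 \<le> T" and T: "\<And>x. szego_gram I l x \<le> T * (\<Sum>i\<in>I. (norm (x i))\<^sup>2)"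
  shows "(\<Sum>i\<in>I. (1 - (norm (l i))\<^sup>2) * (norm (f (l i)))\<^sup>2) \<le> T * hardy_sq_mean f 1"
proof -
  define x where "x i = of_real (wt i) * f (l i)" for i
  define X where "X = (\<Sum>i\<in>I. (norm (x i))\<^sup>2)"
  have "(\<Sum>i\<in>I. cnj (x i) * (of_real (wt i) * f (l i))) = of_real X"
    unfolding X_def x_def[symmetric] of_real_sum complex_norm_square by (intro sum.cong refl mult.commute)
  hence "X\<^sup>2 \<le> hardy_sq_mean f 1 * szego_gram I l x"
    using szego_duality[OF f, of x] by simp
  also have "\<dots> \<le> hardy_sq_mean f 1 * (T * X)"
    using T unfolding X_def by (intro mult_left_mono hardy_sq_mean_nonneg)
  finally have *: "X * X \<le> (T * hardy_sq_mean f 1) * X" by (simp add: power2_eq_square mult_ac)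
  have X: "X = (\<Sum>i\<in>I. (1 - (norm (l i))\<^sup>2) * (norm (f (l i)))\<^sup>2)"
    unfolding X_def x_def by (intro sum.cong refl) (simp add: norm_mult power_mult_distrib w_sq power_le_one disc less_imp_le)
  have X0: "0 \<le> X" unfolding X_def by (intro sum_nonneg) auto
  have "X \<le> T * hardy_sq_mean f 1"
  proof (cases "X = 0")
    case True
    thus ?thesis using T0 hardy_sq_mean_nonneg[of f 1] by simp
  next
    case False
    thus ?thesis using * X0 by simp
  qed
  thus ?thesis by (simp add: X)
qed

lemma szego_gram_eq:
  "of_real (szego_gram I l x) = (\<Sum>i\<in>I. \<Sum>j\<in>I. cnj (x i) * x j * of_real (wt i * wt j) / (1 - cnj (l j) * l i))"
proof -
  define f where "f z = (\<Sum>i\<in>I. x i * unit_szego (l i) z)" for z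
  have h: "f holomorphic_on cball 0 1" unfolding f_def
    by (intro holomorphic_intros unit_szego_holomorphic disc)
  have f: "continuous_on (cball 0 1) f" "f holomorphic_on ball 0 1"
    using holomorphic_on_imp_continuous_on[OF h] holomorphic_on_subset[OF h] by auto
  have "of_real (szego_gram I l x) = hardy_mean f f 1"
    unfolding szego_gram_def f_def by (rule hardy_mean_self[OF szego_sum_continuous, symmetric]) simp
  also have "\<dots> = (\<Sum>i\<in>I. cnj (x i) * (of_real (wt i) * f (l i)))"
    using hardy_mean_szego_sum[OF f, of x] unfolding f_def .
  also have "\<dots> = (\<Sum>i\<in>I. \<Sum>j\<in>I. cnj (x i) * x j * of_real (wt i * wt j) / (1 - cnj (l j) * l i))"
    unfolding f_def sum_distrib_left by (intro sum.cong refl) (simp add: unit_szego_def mult_ac)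
  finally show ?thesis .
qed

text \<open>
  Adding the form at the conjugate vector isolates the real part of the Gram matrix. By
  $2\,\mathrm{Re}\,\frac{1}{1-u} = \frac{1-|u|^2}{|1-u|^2} + 1$ that real part is made of Poisson
  kernels and a rank-one term.
\<close>

lemma szego_gram_add_cnj:
  "szego_gram I l x + szego_gram I l (\<lambda>i. cnj (x i)) =
   (\<Sum>i\<in>I. \<Sum>j\<in>I. Re (cnj (x i) * x j) * (wt i * wt j) *
      ((1 - (norm (l i))\<^sup>2 * (norm (l j))\<^sup>2) / (norm (1 - cnj (l i) * l j))\<^sup>2 + 1))"
proof -
  have two_Re: "1 / (1 - u) + 1 / (1 - cnj u) = of_real ((1 - (norm u)\<^sup>2) / (norm (1 - u))\<^sup>2 + 1)" if "1 - u \<noteq> 0" for u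
  proof -
    have *: "1 / p + 1 / q = (1 - (1 - p) * (1 - q)) / (p * q) + 1" if "p \<noteq> 0" "q \<noteq> 0" for p q :: complex
      using that by (simp add: field_simps)
    have "1 - cnj u \<noteq> 0" using that by (metis complex_cnj_cancel_iff complex_cnj_diff complex_cnj_one complex_cnj_zero_iff)
    from *[OF that this] show ?thesis
      by (simp only: of_real_add of_real_divide of_real_diff of_real_1 complex_norm_square) simp
  qed
  have "complex_of_real (szego_gram I l (\<lambda>i. cnj (x i))) = (\<Sum>j\<in>I. \<Sum>i\<in>I. x j * cnj (x i) * of_real (wt j * wt i) / (1 - cnj (l i) * l j))"
    by (subst szego_gram_eq) simp
  also have "\<dots> = (\<Sum>i\<in>I. \<Sum>j\<in>I. x j * cnj (x i) * of_real (wt j * wt i) / (1 - cnj (l i) * l j))"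
    by (rule sum.swap)
  finally have B: "complex_of_real (szego_gram I l (\<lambda>i. cnj (x i))) = \<dots>" .
  have "complex_of_real (szego_gram I l x + szego_gram I l (\<lambda>i. cnj (x i)))
     = (\<Sum>i\<in>I. \<Sum>j\<in>I. cnj (x i) * x j * of_real (wt i * wt j) * (1 / (1 - cnj (l i) * l j) + 1 / (1 - cnj (cnj (l i) * l j))))"
    unfolding of_real_add B szego_gram_eq[of x] sum.distrib[symmetric]
  proof (intro sum.cong refl)
    fix i j
    define A where "A = cnj (x i) * x j * complex_of_real (wt i * wt j)"
    have A: "x j * cnj (x i) * complex_of_real (wt j * wt i) = A" by (simp add: A_def mult_ac)
    have u: "cnj (cnj (l i) * l j) = cnj (l j) * l i" by (simp add: mult.commute)
    show "cnj (x i) * x j * complex_of_real (wt i * wt j) / (1 - cnj (l j) * l i) + x j * cnj (x i) * complex_of_real (wt j * wt i) / (1 - cnj (l i) * l j) =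
        cnj (x i) * x j * complex_of_real (wt i * wt j) * (1 / (1 - cnj (l i) * l j) + 1 / (1 - cnj (cnj (l i) * l j)))"
      unfolding A A_def[symmetric] u by (simp add: distrib_left)
  qed
  also have "\<dots> = (\<Sum>i\<in>I. \<Sum>j\<in>I. cnj (x i) * x j * of_real ((wt i * wt j) *
      ((1 - (norm (l i))\<^sup>2 * (norm (l j))\<^sup>2) / (norm (1 - cnj (l i) * l j))\<^sup>2 + 1)))"
  proof (intro sum.cong refl)
    fix i j assume "i \<in> I" "j \<in> I"
    hence "1 - cnj (l i) * l j \<noteq> 0" using one_minus_cnj_mult_nonzero disc less_imp_le by blast
    from two_Re[OF this] show "cnj (x i) * x j * of_real (wt i * wt j) * (1 / (1 - cnj (l i) * l j) + 1 / (1 - cnj (cnj (l i) * l j))) =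
       cnj (x i) * x j * of_real ((wt i * wt j) *
      ((1 - (norm (l i))\<^sup>2 * (norm (l j))\<^sup>2) / (norm (1 - cnj (l i) * l j))\<^sup>2 + 1))"
      by (simp only: of_real_mult mult.assoc norm_mult complex_mod_cnj power_mult_distrib)
  qed
  finally have *: "complex_of_real (szego_gram I l x + szego_gram I l (\<lambda>i. cnj (x i))) = \<dots>" .
  have Re_mult: "Re (z * complex_of_real r) = Re z * r" for z r by simp
  from arg_cong[OF *, of Re] show ?thesis
    unfolding Re_sum Re_mult Re_complex_of_real by (simp only: mult.assoc)
qed

text \<open>
  The Poisson kernels and the rank-one term add up to 2 on the diagonal. Off it, the rank-one term is bounded by the total mass
  $\sum_i w_i^2$, and the Poisson kernels by the Vinogradov--Senichkin test, since
  $1-|l_i|^2|l_j|^2 \le w_i^2 + w_j^2 \le 2\max(w_i,w_j)^2$.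
\<close>

lemma szego_gram_add_cnj_le:
  assumes rows: "\<And>i. i \<in> I \<Longrightarrow>
      (\<Sum>j\<in>I-{i}. (1 - (norm (l i))\<^sup>2) * (1 - (norm (l j))\<^sup>2) / (norm (1 - cnj (l i) * l j))\<^sup>2) \<le> \<epsilon>"
    and W: "(\<Sum>i\<in>I. 1 - (norm (l i))\<^sup>2) \<le> W"
  shows "szego_gram I l x + szego_gram I l (\<lambda>i. cnj (x i))
     \<le> (2 + W + 4 * (72 * \<epsilon> + sqrt (4 * \<epsilon> + (72 * \<epsilon>)\<^sup>2))) * (\<Sum>i\<in>I. (norm (x i))\<^sup>2)"
proof -
  define X where "X = (\<Sum>i\<in>I. (norm (x i))\<^sup>2)"
  define d where "d i j = norm (1 - cnj (l i) * l j)" for i j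
  define T where "T i j = (if i \<noteq> j \<and> wt j \<le> wt i then (wt i)^3 * wt j / (d i j)\<^sup>2 else 0)" for i j
  have dpos: "0 < d i j" if "i \<in> I" "j \<in> I" for i j
    unfolding d_def using one_minus_cnj_mult_nonzero[OF disc[OF that(1)] less_imp_le[OF disc[OF that(2)]]] by simp
  have "(\<Sum>i\<in>I. \<Sum>j\<in>I. T i j * norm (x i) * norm (x j))
       \<le> (72 * \<epsilon> + sqrt (4 * \<epsilon> + (72 * \<epsilon>)\<^sup>2)) * (\<Sum>i\<in>I. (norm (x i))\<^sup>2)"
  proof (rule vinogradov_senichkin[where w = "\<lambda>i. wt i" and d = d])
    show "d i j = d j i" for i j unfolding d_def by (rule norm_one_minus_cnj_mult_commute)
    show "d i k \<le> 3 * (d i j + d j k)" if "i \<in> I" "j \<in> I" "k \<in> I" for i j k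
      unfolding d_def by (rule norm_one_minus_cnj_mult_quasi_triangle) (use disc that in auto)
    show "(wt i)\<^sup>2 \<le> 2 * d i j" if "i \<in> I" "j \<in> I" for i j
    proof -
      have "1 - norm (l i) \<le> d i j" unfolding d_def
        using norm_one_minus_cnj_mult_ge[OF disc[OF that(1)] disc[OF that(2)]] by (simp add: norm_one_minus_cnj_mult_commute)
      moreover have "1 - (norm (l i))\<^sup>2 = (1 - norm (l i)) * (1 + norm (l i))" by (simp add: power2_eq_square algebra_simps)
      moreover have "\<dots> \<le> (1 - norm (l i)) * 2" using disc[OF that(1)] by (intro mult_left_mono) auto
      ultimately have "1 - (norm (l i))\<^sup>2 \<le> 2 * d i j" by argo
      thus ?thesis using w_sq[OF that(1)] by (simp only:)
    qed
    show "(\<Sum>j\<in>I - {i}. (wt i)\<^sup>2 * (wt j)\<^sup>2 / (d i j)\<^sup>2) \<le> \<epsilon>" if "i \<in> I" for i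
    proof -
      have "(\<Sum>j\<in>I - {i}. (wt i)\<^sup>2 * (wt j)\<^sup>2 / (d i j)\<^sup>2) =
        (\<Sum>j\<in>I-{i}. (1 - (norm (l i))\<^sup>2) * (1 - (norm (l j))\<^sup>2) / (norm (1 - cnj (l i) * l j))\<^sup>2)"
        using w_sq that by (intro sum.cong refl) (simp only: d_def Diff_iff)
      thus ?thesis using rows[OF that] by simp
    qed
  qed (use fin w_pos dpos T_def in auto)
  hence VS: "(\<Sum>i\<in>I. \<Sum>j\<in>I. T i j * norm (x i) * norm (x j)) \<le> (72 * \<epsilon> + sqrt (4 * \<epsilon> + (72 * \<epsilon>)\<^sup>2)) * X"
    by (simp add: X_def)
  have entry: "Re (cnj (x i) * x j) * (wt i * wt j) * ((1 - (norm (l i))\<^sup>2 * (norm (l j))\<^sup>2) / (d i j)\<^sup>2 + 1)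
     \<le> (if i = j then 2 * (norm (x i))\<^sup>2 else 0) + (norm (x i) * wt i) * (norm (x j) * wt j)
       + 2 * (T i j * norm (x i) * norm (x j)) + 2 * (T j i * norm (x j) * norm (x i))"
    if i: "i \<in> I" and j: "j \<in> I" for i j
  proof (cases "i = j")
    case True
    have "d i i = 1 - (norm (l i))\<^sup>2"
    proof -
      have "1 - cnj (l i) * l i = of_real (1 - (norm (l i))\<^sup>2)" by (simp add: complex_norm_square mult.commute flip: of_real_power)
      thus ?thesis unfolding d_def using w_pos[OF i] by (simp only: norm_of_real) simp
    qed
    moreover have "Re (cnj (x i) * x i) = (norm (x i))\<^sup>2"
      by (simp add: cmod_power2) (simp add: power2_eq_square)
    moreover have "(wt i * wt i) * ((1 - (norm (l i))\<^sup>2 * (norm (l i))\<^sup>2) / (1 - (norm (l i))\<^sup>2)\<^sup>2 + 1) = 2"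
    proof -
      have *: "q * ((1 - (1 - q) * (1 - q)) / q\<^sup>2 + 1) = 2" if "q \<noteq> 0" for q :: real
        using that by (simp add: field_simps power2_eq_square)
      have q: "wt i * wt i = 1 - (norm (l i))\<^sup>2" using w_sq[OF i] by (simp only: power2_eq_square)
      have "1 - (norm (l i))\<^sup>2 \<noteq> 0" using w_pos[OF i] by auto
      from *[OF this] show ?thesis unfolding q by simp
    qed
    moreover have "0 \<le> (norm (x i) * wt i) * (norm (x i) * wt i)" by simp
    ultimately show ?thesis unfolding True[symmetric] by (simp add: T_def mult.assoc)
  next
    case False
    have "Re (cnj (x i) * x j) \<le> norm (cnj (x i) * x j)" by (rule complex_Re_le_cmod)
    hence re: "Re (cnj (x i) * x j) \<le> norm (x i) * norm (x j)" by (simp add: norm_mult)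
    have wi: "0 < wt i" and wj: "0 < wt j" and dij: "0 < d i j" using w_pos dpos i j by auto
    have num: "1 - (norm (l i))\<^sup>2 * (norm (l j))\<^sup>2 \<le> (wt i)\<^sup>2 + (wt j)\<^sup>2"
    proof -
      have "0 \<le> (wt i)\<^sup>2 * (wt j)\<^sup>2" by simp
      thus ?thesis unfolding w_sq[OF i] w_sq[OF j] by (simp add: algebra_simps)
    qed
    have num0: "0 \<le> 1 - (norm (l i))\<^sup>2 * (norm (l j))\<^sup>2"
      using disc[OF i] disc[OF j] by (simp add: mult_le_one power_le_one)
    have Ts: "(wt i * wt j) * (((wt i)\<^sup>2 + (wt j)\<^sup>2) / (d i j)\<^sup>2) \<le> 2 * T i j + 2 * T j i"
    proof -
      have *: "(wt i * wt j) * (((wt i)\<^sup>2 + (wt j)\<^sup>2) / (d i j)\<^sup>2) \<le> 2 * T i j + 2 * T j i"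
        if "i \<in> I" "j \<in> I" "i \<noteq> j" "wt j \<le> wt i" for i j
      proof -
        have wi: "0 < wt i" and wj: "0 < wt j" and dij: "0 < d i j" using w_pos dpos that by auto
        have "(wt j)\<^sup>2 \<le> (wt i)\<^sup>2" using that wj by (intro power_mono) auto
        hence "(wt i * wt j) * (((wt i)\<^sup>2 + (wt j)\<^sup>2) / (d i j)\<^sup>2) \<le> (wt i * wt j) * (((wt i)\<^sup>2 + (wt i)\<^sup>2) / (d i j)\<^sup>2)"
          using wi wj by (intro mult_left_mono divide_right_mono add_left_mono) auto
        also have "\<dots> = 2 * T i j" using that by (simp add: T_def power2_eq_square power3_eq_cube del: real_sqrt_le_iff)
        finally have le: "(wt i * wt j) * (((wt i)\<^sup>2 + (wt j)\<^sup>2) / (d i j)\<^sup>2) \<le> 2 * T i j" .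
        have "0 \<le> T j i" using wi wj by (simp add: T_def)
        thus ?thesis using le by linarith
      qed
      have dsym: "d i j = d j i" unfolding d_def by (rule norm_one_minus_cnj_mult_commute)
      show ?thesis
      proof (cases "wt j \<le> wt i")
        case True thus ?thesis using *[OF i j False] by simp
      next
        case F: False
        hence "(wt j * wt i) * (((wt j)\<^sup>2 + (wt i)\<^sup>2) / (d j i)\<^sup>2) \<le> 2 * T j i + 2 * T i j"
          using *[OF j i] False by auto
        thus ?thesis by (simp only: dsym mult.commute add.commute)
      qed
    qed
    have "Re (cnj (x i) * x j) * (wt i * wt j) * ((1 - (norm (l i))\<^sup>2 * (norm (l j))\<^sup>2) / (d i j)\<^sup>2 + 1)
      \<le> (norm (x i) * norm (x j)) * (wt i * wt j) * (((wt i)\<^sup>2 + (wt j)\<^sup>2) / (d i j)\<^sup>2 + 1)"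
      using re num num0 wi wj
      by (intro mult_mono add_mono divide_right_mono mult_right_mono order_refl) auto
    also have "\<dots> = (norm (x i) * norm (x j)) * ((wt i * wt j) * (((wt i)\<^sup>2 + (wt j)\<^sup>2) / (d i j)\<^sup>2)) + (norm (x i) * wt i) * (norm (x j) * wt j)"
      by (simp add: algebra_simps)
    also have "\<dots> \<le> (norm (x i) * norm (x j)) * (2 * T i j + 2 * T j i) + (norm (x i) * wt i) * (norm (x j) * wt j)"
      using Ts by (intro add_right_mono mult_left_mono) auto
    finally show ?thesis using False by (simp add: algebra_simps)
  qed
  have "szego_gram I l x + szego_gram I l (\<lambda>i. cnj (x i)) \<le>
    (\<Sum>i\<in>I. \<Sum>j\<in>I. (if i = j then 2 * (norm (x i))\<^sup>2 else 0) + (norm (x i) * wt i) * (norm (x j) * wt j)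
       + 2 * (T i j * norm (x i) * norm (x j)) + 2 * (T j i * norm (x j) * norm (x i)))"
    unfolding szego_gram_add_cnj using entry unfolding d_def by (intro sum_mono) auto
  also have "\<dots> = (\<Sum>i\<in>I. \<Sum>j\<in>I. (if i = j then 2 * (norm (x i))\<^sup>2 else 0)) + (\<Sum>i\<in>I. norm (x i) * wt i)\<^sup>2
       + 2 * (\<Sum>i\<in>I. \<Sum>j\<in>I. T i j * norm (x i) * norm (x j)) + 2 * (\<Sum>i\<in>I. \<Sum>j\<in>I. T j i * norm (x j) * norm (x i))"
    unfolding power2_eq_square sum_product by (simp add: sum.distrib sum_distrib_left)
  also have "(\<Sum>i\<in>I. \<Sum>j\<in>I. T j i * norm (x j) * norm (x i)) = (\<Sum>i\<in>I. \<Sum>j\<in>I. T i j * norm (x i) * norm (x j))"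
    by (rule sum.swap)
  also have "(\<Sum>i\<in>I. \<Sum>j\<in>I. (if i = j then 2 * (norm (x i))\<^sup>2 else 0)) = 2 * X"
    using fin by (simp add: X_def sum_distrib_left)
  also have "(\<Sum>i\<in>I. norm (x i) * wt i)\<^sup>2 \<le> X * W"
  proof -
    have "(\<Sum>i\<in>I. norm (x i) * wt i)\<^sup>2 \<le> X * (\<Sum>i\<in>I. (wt i)\<^sup>2)" unfolding X_def by (rule Cauchy_Schwarz_ineq_sum)
    also have "(\<Sum>i\<in>I. (wt i)\<^sup>2) = (\<Sum>i\<in>I. 1 - (norm (l i))\<^sup>2)" using w_sq by (intro sum.cong) auto
    also have "X * \<dots> \<le> X * W" using W unfolding X_def by (intro mult_left_mono sum_nonneg) auto
    finally show ?thesis .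
  qed
  finally show ?thesis using VS unfolding X_def[symmetric] by (simp add: algebra_simps)
qed

text \<open>
  For $f = \sum_i x_i k_i$ and the finite Blaschke product $B$ with zeros $l_i$, the function
  $g = B\,\overline{z f}$ on the circle extends holomorphically to the disc. It has the same norm as
  $f$, and its values at the points $l_i$ are known, so pairing $g$ with
  $\sum_i \beta_i \overline{x_i} k_i$ gives the estimate. It is the form in which
  $G^{-1} = D\,\overline{G}\,D^*$ is needed, namely
  $|y|^4 \le \langle G^{-1}y,y\rangle\langle Gy,y\rangle$ with $y_i = \beta_i\overline{x_i}$.
\<close>

lemma szego_companion:
  fixes x :: "'i \<Rightarrow> complex"
  defines "\<beta> \<equiv> \<lambda>i. \<Prod>j\<in>I-{i}. (l i - l j) / (1 - cnj (l j) * l i)"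
  shows "(\<Sum>i\<in>I. (norm (\<beta> i * x i))\<^sup>2)\<^sup>2 \<le> szego_gram I l x * szego_gram I l (\<lambda>i. \<beta> i * cnj (x i))"
proof -
  define b where "b i z = (z - l i) / (1 - cnj (l i) * z)" for i z
  define g where "g z = (\<Sum>j\<in>I. cnj (x j) * unit_szego (l j) z * (\<Prod>i\<in>I-{j}. b i z))" for z
  define f where "f z = (\<Sum>i\<in>I. x i * unit_szego (l i) z)" for z
  have "g holomorphic_on cball 0 1"
    unfolding g_def b_def
    by (intro holomorphic_intros unit_szego_holomorphic disc) (use one_minus_cnj_mult_nonzero disc in auto)
  hence g: "continuous_on (cball 0 1) g" "g holomorphic_on ball 0 1"
    using holomorphic_on_imp_continuous_on holomorphic_on_subset by auto
  \<comment> \<open>On the circle the kernel is its own conjugate times a unimodular factor; this is what turns \<open>g\<close> into a multiple of the conjugate of \<open>f\<close>.\<close>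
  have b_circle: "norm (b i z) = 1" "unit_szego (l i) z = b i z * cnj z * cnj (unit_szego (l i) z)"
    if z: "norm z = 1" and i: "i \<in> I" for i z
  proof -
    have zz: "z * cnj z = 1" using z by (simp add: complex_norm_square[symmetric])
    have nz: "1 - cnj (l i) * z \<noteq> 0" using one_minus_cnj_mult_nonzero disc[OF i] z by auto
    have cj: "cnj (1 - cnj (l i) * z) = cnj z * (z - l i)" using zz by (simp add: algebra_simps)
    hence "norm (1 - cnj (l i) * z) = norm (z - l i)"
      using z by (metis complex_mod_cnj norm_mult mult_1)
    thus "norm (b i z) = 1" using nz by (auto simp: b_def norm_divide)
    have nz': "cnj z * (z - l i) \<noteq> 0" using nz cj by (metis complex_cnj_zero_iff)
    have "cnj (unit_szego (l i) z) = of_real (wt i) * (1 / cnj (1 - cnj (l i) * z))"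
      by (simp add: unit_szego_def)
    also have "\<dots> = of_real (wt i) * (1 / (cnj z * (z - l i)))" by (simp only: cj)
    finally have "b i z * cnj z * cnj (unit_szego (l i) z) = b i z * cnj z * (of_real (wt i) * (1 / (cnj z * (z - l i))))"
      by (simp only:)
    also have "\<dots> = unit_szego (l i) z"
    proof -
      have *: "q / p * c * (v * (1 / (c * q))) = v * (1 / p)" if "c * q \<noteq> 0" for p q c v :: complex
        using that by simp
      show ?thesis unfolding b_def unit_szego_def by (rule *[OF nz'])
    qed
    finally show "unit_szego (l i) z = b i z * cnj z * cnj (unit_szego (l i) z)" by simp
  qed
  have gf: "norm (g z) = norm (f z)" if z: "norm z = 1" for z
  proof -
    have "g z = (\<Sum>j\<in>I. cnj z * (\<Prod>i\<in>I. b i z) * cnj (x j * unit_szego (l j) z))"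
      unfolding g_def
    proof (rule sum.cong[OF refl])
      fix j assume j: "j \<in> I"
      have "cnj (x j) * unit_szego (l j) z * (\<Prod>i\<in>I-{j}. b i z)
         = cnj (x j) * (b j z * cnj z * cnj (unit_szego (l j) z)) * (\<Prod>i\<in>I-{j}. b i z)"
        using b_circle(2)[OF z j] by simp
      also have "\<dots> = cnj z * (b j z * (\<Prod>i\<in>I-{j}. b i z)) * cnj (x j * unit_szego (l j) z)" by (simp add: mult_ac)
      also have "b j z * (\<Prod>i\<in>I-{j}. b i z) = (\<Prod>i\<in>I. b i z)" using j fin by (simp add: prod.remove)
      finally show "cnj (x j) * unit_szego (l j) z * (\<Prod>i\<in>I-{j}. b i z) = cnj z * (\<Prod>i\<in>I. b i z) * cnj (x j * unit_szego (l j) z)" .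
    qed
    also have "\<dots> = cnj z * (\<Prod>i\<in>I. b i z) * cnj (f z)"
      by (simp add: f_def sum_distrib_left cnj_sum)
    finally show ?thesis using z b_circle(1)[OF z] by (simp add: norm_mult prod_norm[symmetric])
  qed
  have gg: "hardy_sq_mean g 1 = szego_gram I l x"
    unfolding szego_gram_def f_def[symmetric] by (rule hardy_sq_mean_cong) (use gf in auto)
  have val: "of_real (wt i) * g (l i) = \<beta> i * cnj (x i)" if i: "i \<in> I" for i
  proof -
    have "g (l i) = (\<Sum>j\<in>I. if j = i then cnj (x i) * unit_szego (l i) (l i) * \<beta> i else 0)"
      unfolding g_def
    proof (rule sum.cong[OF refl])
      fix j assume j: "j \<in> I"
      show "cnj (x j) * unit_szego (l j) (l i) * (\<Prod>i'\<in>I-{j}. b i' (l i)) = (if j = i then cnj (x i) * unit_szego (l i) (l i) * \<beta> i else 0)"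
      proof (cases "j = i")
        case False
        hence "(\<Prod>i'\<in>I-{j}. b i' (l i)) = 0" using fin i by (intro prod_zero) (auto simp: b_def intro!: bexI[of _ i])
        thus ?thesis using False by simp
      qed (simp add: \<beta>_def b_def)
    qed
    also have "\<dots> = cnj (x i) * unit_szego (l i) (l i) * \<beta> i" using i fin by simp
    finally have *: "g (l i) = cnj (x i) * unit_szego (l i) (l i) * \<beta> i" .
    have D: "1 - cnj (l i) * l i = of_real ((wt i)\<^sup>2)"
      unfolding w_sq[OF i] by (simp add: complex_norm_square mult.commute flip: of_real_power)
    have cancel: "complex_of_real v * (of_real v * (1 / of_real (v\<^sup>2))) = 1" if "v \<noteq> 0" for v
      using that by (simp add: power2_eq_square)
    have "wt i \<noteq> 0" using w_pos[OF i] by auto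
    from cancel[OF this] have one: "of_real (wt i) * unit_szego (l i) (l i) = 1"
      unfolding unit_szego_def D .
    have "of_real (wt i) * g (l i) = (of_real (wt i) * unit_szego (l i) (l i)) * (\<beta> i * cnj (x i))"
      unfolding * by (simp only: mult_ac)
    thus ?thesis unfolding one by simp
  qed
  have "(\<Sum>i\<in>I. cnj (\<beta> i * cnj (x i)) * (of_real (wt i) * g (l i))) = of_real (\<Sum>i\<in>I. (norm (\<beta> i * x i))\<^sup>2)"
    unfolding of_real_sum
  proof (rule sum.cong[OF refl])
    fix i assume i: "i \<in> I"
    have "norm (\<beta> i * x i) = norm (\<beta> i * cnj (x i))" by (simp add: norm_mult)
    thus "cnj (\<beta> i * cnj (x i)) * (of_real (wt i) * g (l i)) = of_real ((norm (\<beta> i * x i))\<^sup>2)"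
      unfolding val[OF i] by (simp only: complex_norm_square mult.commute)
  qed
  with szego_duality[OF g, of "\<lambda>i. \<beta> i * cnj (x i)"]
  have "(norm (complex_of_real (\<Sum>i\<in>I. (norm (\<beta> i * x i))\<^sup>2)))\<^sup>2 \<le> szego_gram I l x * szego_gram I l (\<lambda>i. \<beta> i * cnj (x i))"
    unfolding gg by (simp only:)
  thus ?thesis by (simp only: norm_of_real power2_abs)
qed

text \<open>
  Let $t$ be the best lower bound of the form. The bound on the real part turns $t$ into the upper
  bound $2c-t$, and the conjugation estimate turns that upper bound into the lower bound
  $\delta/(2c-t)$. Since $t$ is best possible, $\delta/(2c-t) \le t$, which confines $t$ to
  the interval $[c-\sqrt{c^2-\delta},\, c+\sqrt{c^2-\delta}]$.
\<close>

lemma szego_gram_le: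
  assumes K: "\<And>x. szego_gram I l x + szego_gram I l (\<lambda>i. cnj (x i)) \<le> 2 * c * (\<Sum>i\<in>I. (norm (x i))\<^sup>2)"
    and \<delta>: "0 < \<delta>" "\<delta> \<le> c\<^sup>2" and c: "0 \<le> c"
    and prods: "\<And>i. i \<in> I \<Longrightarrow> \<delta> \<le> (\<Prod>j\<in>I-{i}. norm ((l i - l j) / (1 - cnj (l j) * l i)))\<^sup>2"
  shows "szego_gram I l x \<le> (c + sqrt (c\<^sup>2 - \<delta>)) * (\<Sum>i\<in>I. (norm (x i))\<^sup>2)"
proof (cases "I = {}")
  case True
  thus ?thesis by (simp add: szego_gram_def hardy_sq_mean_const)
next
  case False
  then obtain i0 where i0: "i0 \<in> I" by auto
  define X where "X x = (\<Sum>i\<in>I. (norm (x i))\<^sup>2)" for x :: "'i \<Rightarrow> complex"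
  define G where "G x = szego_gram I l x" for x
  have X0: "0 \<le> X x" for x unfolding X_def by (intro sum_nonneg) auto
  have G0: "0 \<le> G x" for x unfolding G_def szego_gram_def by (rule hardy_sq_mean_nonneg)
  have Xcnj: "X (\<lambda>i. cnj (x i)) = X x" for x by (simp add: X_def)
  define \<beta> where "\<beta> i = (\<Prod>j\<in>I-{i}. (l i - l j) / (1 - cnj (l j) * l i))" for i
  have \<beta>: "\<delta> \<le> (norm (\<beta> i))\<^sup>2" if "i \<in> I" for i
    using prods[OF that] unfolding \<beta>_def prod_norm[symmetric] .
  define S where "S = {t. 0 \<le> t \<and> (\<forall>x. t * X x \<le> G x)}"
  define e where "e i = (if i = i0 then 1 else 0 :: complex)" for i
  have Xe: "X e = 1"
  proof -
    have "X e = (\<Sum>i\<in>I. if i = i0 then 1 else 0)" unfolding X_def e_def by (intro sum.cong) auto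
    thus ?thesis using i0 fin by simp
  qed
  have "0 \<in> S" using G0 by (auto simp: S_def)
  have bdd: "bdd_above S"
  proof (rule bdd_aboveI)
    fix t assume "t \<in> S"
    hence "t * X e \<le> G e" by (auto simp: S_def)
    thus "t \<le> G e" by (simp add: Xe)
  qed
  define t where "t = Sup S"
  have t0: "0 \<le> t" unfolding t_def by (rule cSup_upper[OF \<open>0 \<in> S\<close> bdd])
  have tX: "t * X x \<le> G x" for x
  proof (cases "X x = 0")
    case True thus ?thesis using G0 by simp
  next
    case False
    hence pos: "0 < X x" using X0[of x] by simp
    have "t \<le> G x / X x" unfolding t_def
      by (rule cSup_least) (use \<open>0 \<in> S\<close> pos in \<open>auto simp: S_def pos_le_divide_eq\<close>)
    thus ?thesis using pos by (simp add: pos_le_divide_eq)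
  qed
  have upper: "G x \<le> (2 * c - t) * X x" for x
  proof -
    have "G x + G (\<lambda>i. cnj (x i)) \<le> 2 * c * X x" using K[of x] by (simp add: G_def X_def)
    thus ?thesis using tX[of "\<lambda>i. cnj (x i)"] by (simp add: Xcnj algebra_simps)
  qed
  have lower: "\<delta> * X x \<le> G x * (2 * c - t)" for x
  proof (cases "X x = 0")
    case True
    have "0 \<le> 2 * c - t" using G0[of e] upper[of e] by (simp add: Xe)
    thus ?thesis using True G0[of x] by simp
  next
    case False
    define Y where "Y = X (\<lambda>i. \<beta> i * x i)"
    have YX: "\<delta> * X x \<le> Y"
      unfolding Y_def X_def sum_distrib_left norm_mult power_mult_distrib
      by (intro sum_mono mult_right_mono \<beta>) auto
    hence "0 < Y" using False X0[of x] \<delta>(1) by (smt (verit) mult_pos_pos)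
    have Y': "X (\<lambda>i. \<beta> i * cnj (x i)) = Y" by (simp add: Y_def X_def norm_mult)
    have "Y\<^sup>2 \<le> G x * G (\<lambda>i. \<beta> i * cnj (x i))"
      using szego_companion[of x] unfolding Y_def X_def G_def \<beta>_def .
    also have "\<dots> \<le> G x * ((2 * c - t) * Y)"
      using upper[of "\<lambda>i. \<beta> i * cnj (x i)"] G0[of x] unfolding Y' by (rule mult_left_mono)
    finally have "Y * Y \<le> (G x * (2 * c - t)) * Y" by (simp add: power2_eq_square mult_ac)
    hence "Y \<le> G x * (2 * c - t)" using \<open>0 < Y\<close> by simp
    thus ?thesis using YX by simp
  qed
  have pos: "0 < 2 * c - t"
  proof -
    have "0 < G e * (2 * c - t)" using lower[of e] \<delta>(1) by (simp add: Xe)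
    thus ?thesis using G0[of e] by (simp add: zero_less_mult_iff)
  qed
  \<comment> \<open>The improved lower bound cannot exceed the supremum \<open>t\<close>.\<close>
  have "\<delta> / (2 * c - t) \<in> S"
    unfolding S_def using pos \<delta>(1) lower by (auto simp: field_simps)
  hence "\<delta> / (2 * c - t) \<le> t" unfolding t_def by (intro cSup_upper bdd)
  hence "\<delta> \<le> t * (2 * c - t)" using pos by (simp add: pos_divide_le_eq)
  hence "(c - t)\<^sup>2 \<le> c\<^sup>2 - \<delta>" by (simp add: power2_eq_square algebra_simps)
  hence "c - t \<le> sqrt (c\<^sup>2 - \<delta>)" by (rule real_le_rsqrt)
  hence "(2 * c - t) * X x \<le> (c + sqrt (c\<^sup>2 - \<delta>)) * X x" using X0 by (intro mult_right_mono) auto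
  thus ?thesis using upper[of x] by (simp add: G_def X_def)
qed

end

section \<open>A Carleson embedding with constant close to one\<close>

lemma sum_one_minus_le_inverse_prod:
  fixes p :: "'i \<Rightarrow> real"
  assumes "finite A" "\<And>i. i \<in> A \<Longrightarrow> 0 < p i \<and> p i \<le> 1"
  shows "1 + (\<Sum>i\<in>A. 1 - p i) \<le> 1 / (\<Prod>i\<in>A. p i)"
  using assms
proof (induction A rule: finite_induct)
  case (insert a A)
  define P where "P = 1 / (\<Prod>i\<in>A. p i)"
  have IH: "1 + (\<Sum>i\<in>A. 1 - p i) \<le> P" unfolding P_def using insert by auto
  have pa: "0 < p a" "p a \<le> 1" using insert by auto
  have "1 \<le> P" using IH sum_nonneg[of A "\<lambda>i. 1 - p i"] insert.prems by fastforce
  have "0 \<le> (1 - p a)\<^sup>2" by simp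
  hence "p a * (2 - p a) \<le> 1" by (simp add: power2_eq_square algebra_simps)
  hence "2 - p a \<le> 1 / p a" using pa by (simp add: pos_le_divide_eq mult.commute)
  have "1 + (\<Sum>i\<in>insert a A. 1 - p i) \<le> P + (1 - p a)" using insert IH by simp
  also have "\<dots> \<le> P + P * (1 - p a)" using \<open>1 \<le> P\<close> pa by (simp add: mult_right_le_one_le mult_le_cancel_right1)
  also have "\<dots> = P * (2 - p a)" by (simp add: algebra_simps)
  also have "\<dots> \<le> P * (1 / p a)" using \<open>2 - p a \<le> 1 / p a\<close> \<open>1 \<le> P\<close> by (intro mult_left_mono) auto
  finally show ?case using insert by (simp add: P_def mult.commute)
qed simp

lemma sum_le_of_pseudohyperbolic_prod_ge:
  fixes l :: "'i \<Rightarrow> complex"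
  assumes fin: "finite I" and disc: "\<And>i. i \<in> I \<Longrightarrow> norm (l i) < 1" and \<epsilon>: "0 \<le> \<epsilon>"
    and prods: "\<And>i. i \<in> I \<Longrightarrow> 1 / (1 + \<epsilon>) \<le> (\<Prod>j\<in>I-{i}. norm ((l i - l j) / (1 - cnj (l j) * l i)))\<^sup>2"
    and i: "i \<in> I"
  shows "(\<Sum>j\<in>I-{i}. (1 - (norm (l i))\<^sup>2) * (1 - (norm (l j))\<^sup>2) / (norm (1 - cnj (l i) * l j))\<^sup>2) \<le> \<epsilon>"
proof -
  define p where "p j = (norm ((l i - l j) / (1 - cnj (l j) * l i)))\<^sup>2" for j
  have pe: "1 - p j = (1 - (norm (l i))\<^sup>2) * (1 - (norm (l j))\<^sup>2) / (norm (1 - cnj (l i) * l j))\<^sup>2" if "j \<in> I" for j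
    unfolding p_def one_minus_pseudohyperbolic_sq[OF disc[OF i] disc[OF that]] norm_one_minus_cnj_mult_commute[of "l i"] ..
  have prod: "1 / (1 + \<epsilon>) \<le> (\<Prod>j\<in>I-{i}. p j)" using prods[OF i] unfolding p_def prod_power_distrib .
  have ppos: "0 < (\<Prod>j\<in>I-{i}. p j)" using \<epsilon> by (intro less_le_trans[OF _ prod]) auto
  have "0 < p j \<and> p j \<le> 1" if j: "j \<in> I - {i}" for j
  proof
    have "p j \<noteq> 0" using ppos j fin by (metis finite_Diff less_irrefl prod_zero)
    thus "0 < p j" unfolding p_def by simp
    have "0 \<le> 1 - p j" using j disc[OF i] disc[of j]
      by (subst pe) (auto intro!: divide_nonneg_nonneg mult_nonneg_nonneg simp: power_le_one)
    thus "p j \<le> 1" by simp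
  qed
  hence "1 + (\<Sum>j\<in>I-{i}. 1 - p j) \<le> 1 / (\<Prod>j\<in>I-{i}. p j)" using fin by (intro sum_one_minus_le_inverse_prod) auto
  also have "\<dots> \<le> 1 / (1 / (1 + \<epsilon>))" using prod \<epsilon> ppos by (intro divide_left_mono) auto
  finally have *: "(\<Sum>j\<in>I-{i}. 1 - p j) \<le> \<epsilon>" by simp
  have "(\<Sum>j\<in>I-{i}. (1 - (norm (l i))\<^sup>2) * (1 - (norm (l j))\<^sup>2) / (norm (1 - cnj (l i) * l j))\<^sup>2) = (\<Sum>j\<in>I-{i}. 1 - p j)"
    using pe by (intro sum.cong) auto
  thus ?thesis using * by simp
qed

text \<open>
  The value $c + \sqrt{c^2-\delta}$ for $\delta = 1/(1+\epsilon)$, where $2c$ is the bound on the sum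
  of the Gram matrix and its conjugate when both the row sums and the total mass are at most $\epsilon$.
\<close>

definition thin_carleson_bound :: "real \<Rightarrow> real" where
  "thin_carleson_bound \<epsilon> =
     (let c = 1 + \<epsilon> / 2 + 2 * (72 * \<epsilon> + sqrt (4 * \<epsilon> + (72 * \<epsilon>)\<^sup>2)) in c + sqrt (c\<^sup>2 - 1 / (1 + \<epsilon>)))"

lemma thin_carleson_bound_tendsto: "(thin_carleson_bound \<longlongrightarrow> 1) (at_right 0)"
proof -
  have "continuous (at 0) thin_carleson_bound"
    unfolding thin_carleson_bound_def Let_def by (intro continuous_intros) auto
  hence "(thin_carleson_bound \<longlongrightarrow> thin_carleson_bound 0) (at 0)" by (simp add: isCont_def)
  moreover have "thin_carleson_bound 0 = 1" by (simp add: thin_carleson_bound_def)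
  ultimately show ?thesis by (metis filterlim_at_split)
qed

lemma thin_carleson_bound_nonneg:
  assumes "0 \<le> \<epsilon>" shows "0 \<le> thin_carleson_bound \<epsilon>"
proof -
  define c where "c = 1 + \<epsilon> / 2 + 2 * (72 * \<epsilon> + sqrt (4 * \<epsilon> + (72 * \<epsilon>)\<^sup>2))"
  have c1: "1 \<le> c" using assms unfolding c_def by (simp add: add_nonneg_nonneg)
  have "1 / (1 + \<epsilon>) \<le> 1" using assms by simp
  also have "1 \<le> c\<^sup>2" using c1 by (rule one_le_power)
  finally show ?thesis unfolding thin_carleson_bound_def Let_def c_def[symmetric] using c1
    by (simp add: add_nonneg_nonneg)
qed

lemma finite_carleson_embedding:
  fixes l :: "'i \<Rightarrow> complex"
  assumes fin: "finite I" and disc: "\<And>i. i \<in> I \<Longrightarrow> norm (l i) < 1" and \<epsilon>: "0 \<le> \<epsilon>"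
    and prods: "\<And>i. i \<in> I \<Longrightarrow> 1 / (1 + \<epsilon>) \<le> (\<Prod>j\<in>I-{i}. norm ((l i - l j) / (1 - cnj (l j) * l i)))\<^sup>2"
    and W: "(\<Sum>i\<in>I. 1 - (norm (l i))\<^sup>2) \<le> \<epsilon>"
    and f: "continuous_on (cball 0 1) f" "f holomorphic_on ball 0 1"
  shows "(\<Sum>i\<in>I. (1 - (norm (l i))\<^sup>2) * (norm (f (l i)))\<^sup>2) \<le> thin_carleson_bound \<epsilon> * hardy_sq_mean f 1"
proof -
  define c where "c = 1 + \<epsilon> / 2 + 2 * (72 * \<epsilon> + sqrt (4 * \<epsilon> + (72 * \<epsilon>)\<^sup>2))"
  have c1: "1 \<le> c" using \<epsilon> unfolding c_def by (simp add: add_nonneg_nonneg)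
  hence c2: "1 \<le> c\<^sup>2" by (simp add: one_le_power)
  have e1: "1 / (1 + \<epsilon>) \<le> 1" using \<epsilon> by simp
  note rows = sum_le_of_pseudohyperbolic_prod_ge[OF fin disc \<epsilon> prods]
  have "szego_gram I l x \<le> thin_carleson_bound \<epsilon> * (\<Sum>i\<in>I. (norm (x i))\<^sup>2)" for x
    unfolding thin_carleson_bound_def Let_def c_def[symmetric]
  proof (rule szego_gram_le[OF fin disc _ _ _ _ prods])
    fix x
    show "szego_gram I l x + szego_gram I l (\<lambda>i. cnj (x i)) \<le> 2 * c * (\<Sum>i\<in>I. (norm (x i))\<^sup>2)"
      using szego_gram_add_cnj_le[OF fin disc rows W, of x] by (simp add: c_def algebra_simps)
  qed (use \<epsilon> c1 order_trans[OF e1 c2] in auto)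
  moreover note thin_carleson_bound_nonneg[OF \<epsilon>]
  ultimately show ?thesis 
    using carleson_of_szego_gram[where I = I and l = l and T = "thin_carleson_bound \<epsilon>", OF fin disc f] by blast
qed

section \<open>The Hardy space\<close>

lemma hardy2_sq_mean_le:
  assumes "f \<in> hardy2" "0 \<le> r" "r < 1"
  shows "hardy_sq_mean f r \<le> (hardy_norm f)\<^sup>2"
proof -
  have bdd: "bdd_above (hardy_sq_mean f ` {0..<1})" using assms by (simp add: hardy2_def)
  have le: "hardy_sq_mean f r \<le> (SUP r\<in>{0..<1}. hardy_sq_mean f r)"
    by (rule cSUP_upper[OF _ bdd]) (use assms in auto)
  hence "0 \<le> (SUP r\<in>{0..<1}. hardy_sq_mean f r)" using hardy_sq_mean_nonneg order_trans by blast
  thus ?thesis using le by (simp add: hardy_norm_def)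
qed

lemma hardy_norm_eq_limit:
  assumes f: "f holomorphic_on ball 0 1" and L: "(hardy_sq_mean f \<longlongrightarrow> L) (at_left 1)"
  shows "f \<in> hardy2" "(hardy_norm f)\<^sup>2 = L"
proof -
  have le: "hardy_sq_mean f r \<le> L" if "0 \<le> r" "r < 1" for r
  proof (rule tendsto_lowerbound[OF L])
    have "eventually (\<lambda>s. s \<in> {r<..<1}) (at_left 1)" using that by (intro eventually_at_left_real) auto
    thus "eventually (\<lambda>s. hardy_sq_mean f r \<le> hardy_sq_mean f s) (at_left 1)"
      by eventually_elim (use that in \<open>auto intro!: hardy_sq_mean_increasing f\<close>)
  qed auto
  have bdd: "bdd_above (hardy_sq_mean f ` {0..<1})" using le by (auto intro!: bdd_aboveI)
  thus h: "f \<in> hardy2" using f by (simp add: hardy2_def)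
  have "(SUP r\<in>{0..<1}. hardy_sq_mean f r) \<le> L" by (rule cSUP_least) (use le in auto)
  hence "(hardy_norm f)\<^sup>2 \<le> L" unfolding hardy_norm_def
    using hardy_sq_mean_nonneg[of f 0] cSUP_upper[OF _ bdd, of 0] by simp
  moreover have "L \<le> (hardy_norm f)\<^sup>2"
  proof (rule tendsto_upperbound[OF L])
    have "eventually (\<lambda>s. s \<in> {0<..<1}) (at_left (1::real))" by (intro eventually_at_left_real) auto
    thus "eventually (\<lambda>s. hardy_sq_mean f s \<le> (hardy_norm f)\<^sup>2) (at_left 1)"
      by eventually_elim (auto intro!: hardy2_sq_mean_le h)
  qed auto
  ultimately show "(hardy_norm f)\<^sup>2 = L" by simp
qed

lemma tendsto_dilate_at_left:
  assumes "f holomorphic_on ball 0 1" "norm z < 1"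
  shows "((\<lambda>r. f (complex_of_real r * z)) \<longlongrightarrow> f z) (at_left 1)"
    "((\<lambda>r. f ((complex_of_real r)\<^sup>2 * z)) \<longlongrightarrow> f z) (at_left 1)"
proof -
  have c: "isCont f z"
    using holomorphic_on_imp_continuous_on[OF assms(1)] assms(2) by (simp add: continuous_on_eq_continuous_at)
  have "((\<lambda>r. complex_of_real r * z) \<longlongrightarrow> of_real 1 * z) (at_left 1)" by (intro tendsto_intros)
  thus "((\<lambda>r. f (complex_of_real r * z)) \<longlongrightarrow> f z) (at_left 1)" using isCont_tendsto_compose[OF c] by simp
  have "((\<lambda>r. (complex_of_real r)\<^sup>2 * z) \<longlongrightarrow> (of_real 1)\<^sup>2 * z) (at_left 1)" by (intro tendsto_intros)
  thus "((\<lambda>r. f ((complex_of_real r)\<^sup>2 * z)) \<longlongrightarrow> f z) (at_left 1)" using isCont_tendsto_compose[OF c] by simp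
qed

lemma eventually_at_left_1: "eventually (\<lambda>r::real. 0 < r \<and> r < 1) (at_left 1)"
  using eventually_at_left_real[of 0 1] by simp

text \<open>
  Elements of $H^2$ need not extend continuously to the closed disc, so the embedding is applied to
  the dilates $f(rz)$, and then $r \to 1$.
\<close>

lemma hardy2_finite_carleson_embedding:
  fixes l :: "'i \<Rightarrow> complex"
  assumes fin: "finite I" and disc: "\<And>i. i \<in> I \<Longrightarrow> norm (l i) < 1" and \<epsilon>: "0 \<le> \<epsilon>"
    and prods: "\<And>i. i \<in> I \<Longrightarrow> 1 / (1 + \<epsilon>) \<le> (\<Prod>j\<in>I-{i}. norm ((l i - l j) / (1 - cnj (l j) * l i)))\<^sup>2"
    and W: "(\<Sum>i\<in>I. 1 - (norm (l i))\<^sup>2) \<le> \<epsilon>"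
    and f: "f \<in> hardy2"
  shows "(\<Sum>i\<in>I. (1 - (norm (l i))\<^sup>2) * (norm (f (l i)))\<^sup>2) \<le> thin_carleson_bound \<epsilon> * (hardy_norm f)\<^sup>2"
proof -
  have hol: "f holomorphic_on ball 0 1" using f by (simp add: hardy2_def)
  have T0: "0 \<le> thin_carleson_bound \<epsilon>" by (rule thin_carleson_bound_nonneg[OF \<epsilon>])
  have *: "((\<lambda>r. \<Sum>i\<in>I. (1 - (norm (l i))\<^sup>2) * (norm (f (of_real r * l i)))\<^sup>2) \<longlongrightarrow>
      (\<Sum>i\<in>I. (1 - (norm (l i))\<^sup>2) * (norm (f (l i)))\<^sup>2)) (at_left 1)"
    by (intro tendsto_intros tendsto_dilate_at_left hol disc)
  show ?thesis
  proof (rule tendsto_upperbound[OF *])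
    show "eventually (\<lambda>r. (\<Sum>i\<in>I. (1 - (norm (l i))\<^sup>2) * (norm (f (of_real r * l i)))\<^sup>2) \<le> thin_carleson_bound \<epsilon> * (hardy_norm f)\<^sup>2) (at_left 1)"
      using eventually_at_left_1
    proof eventually_elim
      case (elim r)
      define F where "F z = f (of_real r * z)" for z
      have sub: "of_real r * z \<in> ball 0 1" if "z \<in> cball 0 1" for z :: complex
      proof -
        have "r * norm z \<le> r * 1" using that elim by (intro mult_left_mono) auto
        hence "r * norm z < 1" using elim by linarith
        thus ?thesis using elim by (simp add: norm_mult)
      qed
      have "F holomorphic_on cball 0 1" unfolding F_def
        by (rule holomorphic_on_compose_gen[OF _ hol, unfolded o_def]) (use sub in \<open>auto intro!: holomorphic_intros\<close>)
      hence "continuous_on (cball 0 1) F" "F holomorphic_on ball 0 1"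
        using holomorphic_on_imp_continuous_on holomorphic_on_subset by auto
      hence "(\<Sum>i\<in>I. (1 - (norm (l i))\<^sup>2) * (norm (F (l i)))\<^sup>2) \<le> thin_carleson_bound \<epsilon> * hardy_sq_mean F 1"
        by (intro finite_carleson_embedding fin disc \<epsilon> prods W)
      also have "hardy_sq_mean F 1 = hardy_sq_mean f r" unfolding F_def[abs_def] by (rule hardy_sq_mean_dilate)
      also have "thin_carleson_bound \<epsilon> * \<dots> \<le> thin_carleson_bound \<epsilon> * (hardy_norm f)\<^sup>2"
        using elim by (intro mult_left_mono hardy2_sq_mean_le f T0) auto
      finally show ?case by (simp add: F_def)
    qed
  qed auto
qed

text \<open>
  The embedding for a single point, where the empty product is 1 and the constant belonging to
  $\epsilon = 1$ is available.
\<close>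

lemma hardy_norm_pos:
  assumes f: "f \<in> hardy2" and z: "norm z < 1" "f z \<noteq> 0"
  shows "0 < (hardy_norm f)\<^sup>2"
proof -
  have "(\<Sum>i\<in>{z}. (1 - (norm i)\<^sup>2) * (norm (f i))\<^sup>2) \<le> thin_carleson_bound 1 * (hardy_norm f)\<^sup>2"
    by (rule hardy2_finite_carleson_embedding) (use z f in auto)
  moreover have "0 < (1 - (norm z)\<^sup>2) * (norm (f z))\<^sup>2" using z by (simp add: power_less_one_iff)
  ultimately have "0 < thin_carleson_bound 1 * (hardy_norm f)\<^sup>2" by simp
  thus ?thesis using thin_carleson_bound_nonneg[of 1] by (auto simp: zero_less_mult_iff)
qed

section \<open>Kernels of the model space\<close>

text \<open>
  The radial limits of modulus one enter the argument only through this limit, which is an instance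
  of dominated convergence.
\<close>

lemma inner_function_sq_mean_tendsto:
  assumes "inner_function \<Theta>"
  shows "(hardy_sq_mean \<Theta> \<longlongrightarrow> 1) (at_left 1)"
proof (rule tendsto_at_left_sequentially[of 0])
  fix S :: "nat \<Rightarrow> real" assume S: "\<And>n. S n < 1" "\<And>n. 0 < S n" "S \<longlonglongrightarrow> 1"
  have hol: "\<Theta> holomorphic_on ball 0 1" and bd: "\<And>z. norm z < 1 \<Longrightarrow> norm (\<Theta> z) \<le> 1"
    and lim: "AE t\<in>{0..2*pi} in lborel. \<exists>l. norm l = 1 \<and> ((\<lambda>r. \<Theta> (of_real r * cis t)) \<longlongrightarrow> l) (at_left 1)"
    using assms by (auto simp: inner_function_def)
  have S1: "filterlim S (at_left 1) sequentially"
    using S less_imp_neq[OF S(1)] by (auto simp: filterlim_at)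
  have c: "continuous_on (sphere 0 (S n)) \<Theta>" for n
    by (rule continuous_on_subset[OF holomorphic_on_imp_continuous_on[OF hol]]) (use S in auto)
  define h where "h n t = (norm (\<Theta> (of_real (S n) * cis t)))\<^sup>2" for n t
  have hint: "set_integrable lborel {0..2*pi} (h n)" for n
    unfolding h_def by (rule borel_integrable_atLeastAtMost')
      (intro continuous_intros continuous_on_circle_param c less_imp_le S)
  have "(\<lambda>n. LINT t|lborel. indicator {0..2*pi} t *\<^sub>R h n t) \<longlonglongrightarrow> (LINT t|lborel. indicator {0..2*pi} t *\<^sub>R (1::real))"
  proof (rule integral_dominated_convergence[where w = "indicator {0..2*pi}"])
    show "(\<lambda>t. indicator {0..2*pi} t *\<^sub>R h n t) \<in> borel_measurable lborel" for n
      using hint[of n] unfolding set_integrable_def by (rule borel_measurable_integrable)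
    show "AE t in lborel. (\<lambda>n. indicator {0..2*pi} t *\<^sub>R h n t) \<longlonglongrightarrow> indicator {0..2*pi} t *\<^sub>R (1::real)"
      using lim
    proof eventually_elim
      case (elim t)
      show ?case
      proof (cases "t \<in> {0..2*pi}")
        case True
        then obtain m where m: "norm m = 1" "((\<lambda>r. \<Theta> (of_real r * cis t)) \<longlongrightarrow> m) (at_left 1)" using elim by auto
        have "(\<lambda>n. \<Theta> (of_real (S n) * cis t)) \<longlonglongrightarrow> m" by (rule filterlim_compose[OF m(2) S1])
        hence "(\<lambda>n. (norm (\<Theta> (of_real (S n) * cis t)))\<^sup>2) \<longlonglongrightarrow> (norm m)\<^sup>2" by (intro tendsto_intros)
        thus ?thesis using True m by (simp add: h_def)
      qed auto
    qed
    show "AE t in lborel. norm (indicator {0..2*pi} t *\<^sub>R h n t) \<le> indicator {0..2*pi} t" for n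
    proof (rule AE_I2)
      fix t
      have "norm (of_real (S n) * cis t) < 1" using S(1)[of n] S(2)[of n] by (simp add: norm_mult)
      hence "h n t \<le> 1" unfolding h_def using bd by (intro power_le_one) auto
      thus "norm (indicator {0..2*pi} t *\<^sub>R h n t) \<le> indicator {0..2*pi} t"
        by (auto simp: h_def indicator_def)
    qed
  qed auto
  moreover have "(LINT t|lborel. indicator {0..2*pi} t *\<^sub>R h n t) = integral {0..2*pi} (h n)" for n
    using set_borel_integral_eq_integral(2)[OF hint[of n]] unfolding set_lebesgue_integral_def .
  ultimately have "(\<lambda>n. integral {0..2*pi} (h n)) \<longlonglongrightarrow> 2 * pi" by simp
  hence "(\<lambda>n. integral {0..2*pi} (h n) / (2 * pi)) \<longlonglongrightarrow> (2 * pi) / (2 * pi)" by (intro tendsto_intros) auto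
  thus "(\<lambda>n. hardy_sq_mean \<Theta> (S n)) \<longlonglongrightarrow> 1" by (simp add: hardy_sq_mean_def h_def[abs_def])
qed simp

context
  fixes \<Theta> :: "complex \<Rightarrow> complex" and w :: complex
  assumes inner: "inner_function \<Theta>" and w: "norm w < 1"
begin

abbreviation (input) "szego \<equiv> (\<lambda>z. 1 / (1 - cnj w * z))"

lemma \<Theta>_holomorphic: "\<Theta> holomorphic_on ball 0 1"
  and \<Theta>_le: "norm z < 1 \<Longrightarrow> norm (\<Theta> z) \<le> 1"
  using inner by (auto simp: inner_function_def)

lemma szego_holomorphic: "szego holomorphic_on ball 0 1"
  by (intro holomorphic_intros) (use one_minus_cnj_mult_nonzero[OF w] in auto)

lemma sphere_continuous:
  assumes "f holomorphic_on ball 0 1" "r < 1"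
  shows "continuous_on (sphere 0 r) f"
  by (rule continuous_on_subset[OF holomorphic_on_imp_continuous_on[OF assms(1)]]) (use assms(2) in auto)

lemma hardy_mean_szego_tendsto:
  assumes g: "g holomorphic_on ball 0 1"
  shows "((\<lambda>r. hardy_mean g szego r) \<longlongrightarrow> g w) (at_left 1)"
proof -
  have "eventually (\<lambda>r. g ((of_real r)\<^sup>2 * w) = hardy_mean g szego r) (at_left 1)"
    using eventually_at_left_1
  proof eventually_elim
    case (elim r)
    have "r * norm w \<le> 1 * norm w" using elim by (intro mult_right_mono) auto
    hence "r * norm w < 1" using w by simp
    thus ?case using elim
      by (intro hardy_mean_szego[symmetric] continuous_on_subset[OF holomorphic_on_imp_continuous_on[OF g]] holomorphic_on_subset[OF g]) auto
  qed
  thus ?thesis using tendsto_dilate_at_left(2)[OF g w] by (rule Lim_transform_eventually[rotated])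
qed

lemma hardy_mean_szego_left_tendsto:
  assumes g: "g holomorphic_on ball 0 1"
  shows "((\<lambda>r. hardy_mean szego g r) \<longlongrightarrow> cnj (g w)) (at_left 1)"
  by (subst hardy_mean_cnj) (intro tendsto_intros hardy_mean_szego_tendsto g)

text \<open>
  Multiplication by $\Theta$ preserves inner products in the limit $r \to 1$. The error is the mean of
  $(1-|\Theta|^2)\,k\,\overline{g}$, and by the Cauchy--Schwarz inequality its square is at most a
  constant times the mean of $1-|\Theta|^2$, which tends to 0.
\<close>

lemma hardy_mean_inner_isometry:
  assumes g: "g holomorphic_on ball 0 1" and B: "\<And>r. 0 < r \<Longrightarrow> r < 1 \<Longrightarrow> hardy_sq_mean g r \<le> B"
  shows "((\<lambda>r. hardy_mean (\<lambda>z. \<Theta> z * szego z) (\<lambda>z. \<Theta> z * g z) r) \<longlongrightarrow> cnj (g w)) (at_left 1)"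
proof -
  define C where "C = (1 / (1 - norm w))\<^sup>2"
  define D where "D r = hardy_mean szego g r - hardy_mean (\<lambda>z. \<Theta> z * szego z) (\<lambda>z. \<Theta> z * g z) r" for r
  have D_le: "(norm (D r))\<^sup>2 \<le> C * (1 - hardy_sq_mean \<Theta> r) * B" if r: "0 < r" "r < 1" for r
  proof -
    note cts = sphere_continuous[OF _ r(2)]
    define d where "d z = complex_of_real (1 - (norm (\<Theta> z))\<^sup>2)" for z
    have cd: "continuous_on (sphere 0 r) d"
      unfolding d_def by (intro continuous_intros cts \<Theta>_holomorphic)
    have cdk: "continuous_on (sphere 0 r) (\<lambda>z. d z * szego z)" by (rule continuous_on_mult[OF cd cts[OF szego_holomorphic]])
    have "D r = hardy_mean (\<lambda>z. d z * szego z) g r"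
    proof -
      have "hardy_mean (\<lambda>z. \<Theta> z * szego z) (\<lambda>z. \<Theta> z * g z) r = hardy_mean (\<lambda>z. szego z - d z * szego z) g r"
      proof (rule hardy_mean_cong)
        fix z
        have ring_id: "p * q * (p' * g') = (q - (1 - p * p') * q) * g'" for p q p' g' :: complex
          by (simp add: algebra_simps)
        have "d z = 1 - \<Theta> z * cnj (\<Theta> z)" unfolding d_def of_real_diff complex_norm_square by simp
        thus "\<Theta> z * szego z * cnj (\<Theta> z * g z) = (szego z - d z * szego z) * cnj (g z)"
          using ring_id[of "\<Theta> z" "szego z" "cnj (\<Theta> z)" "cnj (g z)"] by (simp only: complex_cnj_mult)
      qed (use r in auto)
      also have "\<dots> = hardy_mean szego g r - hardy_mean (\<lambda>z. d z * szego z) g r"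
        using r by (intro hardy_mean_diff_left cts szego_holomorphic g cdk) auto
      finally show ?thesis by (simp add: D_def)
    qed
    hence "(norm (D r))\<^sup>2 \<le> hardy_sq_mean (\<lambda>z. d z * szego z) r * hardy_sq_mean g r"
      using hardy_mean_Cauchy_Schwarz[OF cdk cts[OF g]] r by simp
    also have "\<dots> \<le> (C * (1 - hardy_sq_mean \<Theta> r)) * B"
    proof (rule mult_mono)
      have k_le: "(norm (szego z))\<^sup>2 \<le> C" if "norm z = r" for z
      proof -
        have "1 - norm w \<le> norm (1 - cnj w * z)"
          using norm_one_minus_cnj_mult_ge[of w z] w r that by (simp add: norm_one_minus_cnj_mult_commute)
        hence "norm (szego z) \<le> 1 / (1 - norm w)" using w by (simp add: norm_divide frac_le)
        thus ?thesis unfolding C_def by (intro power_mono) auto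
      qed
      have "integral {0..2*pi} (\<lambda>t. (norm (d (of_real r * cis t) * szego (of_real r * cis t)))\<^sup>2)
         \<le> integral {0..2*pi} (\<lambda>t. C * (1 - (norm (\<Theta> (of_real r * cis t)))\<^sup>2))"
      proof (rule integral_le)
        show "(\<lambda>t. (norm (d (of_real r * cis t) * szego (of_real r * cis t)))\<^sup>2) integrable_on {0..2*pi}"
          using hardy_sq_mean_integrable[OF cdk] r by simp
        show "(\<lambda>t. C * (1 - (norm (\<Theta> (of_real r * cis t)))\<^sup>2)) integrable_on {0..2*pi}"
          using r by (intro integrable_continuous_interval continuous_intros continuous_on_circle_param cts \<Theta>_holomorphic) auto
        fix t
        define z where "z = of_real r * cis t"
        have z: "norm z = r" using r by (simp add: z_def norm_mult)
        define q where "q = 1 - (norm (\<Theta> z))\<^sup>2"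
        have q: "0 \<le> q" "q \<le> 1" unfolding q_def using \<Theta>_le[of z] z r by (auto simp: power_le_one)
        have "(norm (d z * szego z))\<^sup>2 = q\<^sup>2 * (norm (szego z))\<^sup>2" 
          unfolding d_def q_def norm_mult power_mult_distrib norm_of_real power2_abs ..
        also have "\<dots> \<le> q * C"
          using q k_le[OF z] by (intro mult_mono) (auto simp: power2_eq_square mult_left_le)
        finally show "(norm (d (of_real r * cis t) * szego (of_real r * cis t)))\<^sup>2 \<le> C * (1 - (norm (\<Theta> (of_real r * cis t)))\<^sup>2)"
          by (simp add: z_def q_def mult.commute)
      qed
      also have "\<dots> = C * (2 * pi - integral {0..2*pi} (\<lambda>t. (norm (\<Theta> (of_real r * cis t)))\<^sup>2))"
        using r by (subst integral_mult_right, subst integral_diff)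
          (auto intro!: hardy_sq_mean_integrable cts \<Theta>_holomorphic)
      finally show "hardy_sq_mean (\<lambda>z. d z * szego z) r \<le> C * (1 - hardy_sq_mean \<Theta> r)"
        unfolding hardy_sq_mean_def by (simp add: field_simps)
      thus "0 \<le> C * (1 - hardy_sq_mean \<Theta> r)" using hardy_sq_mean_nonneg order_trans by blast
    qed (use B r hardy_sq_mean_nonneg in auto)
    finally show ?thesis .
  qed
  have "((\<lambda>r. (norm (D r))\<^sup>2) \<longlongrightarrow> 0) (at_left 1)"
  proof (rule tendsto_sandwich[OF _ _ tendsto_const])
    have "((\<lambda>r. C * (1 - hardy_sq_mean \<Theta> r) * B) \<longlongrightarrow> C * (1 - 1) * B) (at_left 1)"
      by (intro tendsto_intros inner_function_sq_mean_tendsto inner)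
    thus "((\<lambda>r. C * (1 - hardy_sq_mean \<Theta> r) * B) \<longlongrightarrow> 0) (at_left 1)" by simp
    show "eventually (\<lambda>r. (norm (D r))\<^sup>2 \<le> C * (1 - hardy_sq_mean \<Theta> r) * B) (at_left 1)"
      using eventually_at_left_1 by eventually_elim (use D_le in auto)
  qed auto
  hence "((\<lambda>r. sqrt ((norm (D r))\<^sup>2)) \<longlongrightarrow> sqrt 0) (at_left 1)" by (rule tendsto_real_sqrt)
  hence "(D \<longlongrightarrow> 0) (at_left 1)" by (simp add: tendsto_norm_zero_iff)
  hence "((\<lambda>r. hardy_mean szego g r - D r) \<longlongrightarrow> cnj (g w) - 0) (at_left 1)"
    by (intro tendsto_diff hardy_mean_szego_left_tendsto g)
  thus ?thesis by (simp add: D_def)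
qed

lemma model_kernel_eq: "model_kernel \<Theta> w = (\<lambda>z. szego z - cnj (\<Theta> w) * (\<Theta> z * szego z))"
  by (auto simp: model_kernel_def fun_eq_iff diff_divide_distrib)

lemma model_kernel_holomorphic: "model_kernel \<Theta> w holomorphic_on ball 0 1"
  unfolding model_kernel_eq by (intro holomorphic_on_diff holomorphic_on_mult holomorphic_on_const szego_holomorphic \<Theta>_holomorphic)

lemma model_kernel_orthogonal:
  assumes g: "g holomorphic_on ball 0 1" and B: "\<And>r. 0 < r \<Longrightarrow> r < 1 \<Longrightarrow> hardy_sq_mean g r \<le> B"
  shows "((\<lambda>r. hardy_mean (model_kernel \<Theta> w) (\<lambda>z. \<Theta> z * g z) r) \<longlongrightarrow> 0) (at_left 1)"
proof -
  have \<Theta>g: "(\<lambda>z. \<Theta> z * g z) holomorphic_on ball 0 1" by (intro holomorphic_on_mult g \<Theta>_holomorphic)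
  have \<Theta>szego: "(\<lambda>z. \<Theta> z * szego z) holomorphic_on ball 0 1" by (intro holomorphic_on_mult szego_holomorphic \<Theta>_holomorphic)
  have "((\<lambda>r. hardy_mean szego (\<lambda>z. \<Theta> z * g z) r - cnj (\<Theta> w) * hardy_mean (\<lambda>z. \<Theta> z * szego z) (\<lambda>z. \<Theta> z * g z) r)
     \<longlongrightarrow> cnj (\<Theta> w * g w) - cnj (\<Theta> w) * cnj (g w)) (at_left 1)"
    by (intro tendsto_diff tendsto_mult tendsto_const hardy_mean_szego_left_tendsto[OF \<Theta>g] hardy_mean_inner_isometry[OF g B])
  moreover have "eventually (\<lambda>r. hardy_mean szego (\<lambda>z. \<Theta> z * g z) r - cnj (\<Theta> w) * hardy_mean (\<lambda>z. \<Theta> z * szego z) (\<lambda>z. \<Theta> z * g z) r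
      = hardy_mean (model_kernel \<Theta> w) (\<lambda>z. \<Theta> z * g z) r) (at_left 1)"
    using eventually_at_left_1
  proof eventually_elim
    case (elim r)
    note cts = sphere_continuous[OF _ conjunct2[OF elim]]
    show ?case unfolding model_kernel_eq
      using elim by (subst hardy_mean_diff_left)
        (auto intro!: cts \<Theta>g \<Theta>szego szego_holomorphic continuous_on_mult[OF continuous_on_const cts[OF \<Theta>szego]] simp: hardy_mean_mult_left simp del: times_divide_eq_right)
  qed
  ultimately show ?thesis by (simp add: Lim_transform_eventually)
qed

lemma szego_sq_mean_le:
  assumes "0 < r" "r < 1" shows "hardy_sq_mean szego r \<le> (1 / (1 - norm w))\<^sup>2"
proof -
  have "hardy_sq_mean szego r \<le> hardy_sq_mean (\<lambda>_. of_real (1 / (1 - norm w))) r"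
  proof (rule hardy_sq_mean_mono)
    fix z :: complex assume "norm z = r"
    hence "1 - norm w \<le> norm (1 - cnj w * z)"
      using norm_one_minus_cnj_mult_ge[of w z] w assms by (simp add: norm_one_minus_cnj_mult_commute)
    hence "norm (szego z) \<le> 1 / (1 - norm w)" using w by (simp add: norm_divide frac_le)
    also have "\<dots> = norm (complex_of_real (1 / (1 - norm w)))" using w by (simp only: norm_of_real) simp
    finally show "norm (szego z) \<le> norm (complex_of_real (1 / (1 - norm w)))" .
  qed (use assms in \<open>auto intro!: sphere_continuous szego_holomorphic\<close>)
  thus ?thesis using w by (simp only: hardy_sq_mean_const norm_of_real power2_abs)
qed

text \<open>
  Since $K = k - \overline{\Theta(w)}\,\Theta k$ is orthogonal to $\Theta k$ in the limit, its squared
  norm is the limit of the inner products of $K$ with $k$, which is $K(w)$.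
\<close>

lemma model_kernel_sq_mean_tendsto:
  "(hardy_sq_mean (model_kernel \<Theta> w) \<longlongrightarrow> (1 - (norm (\<Theta> w))\<^sup>2) / (1 - (norm w)\<^sup>2)) (at_left 1)"
proof -
  define K where "K = model_kernel \<Theta> w"
  have K: "K holomorphic_on ball 0 1" unfolding K_def by (rule model_kernel_holomorphic)
  have \<Theta>szego: "(\<lambda>z. \<Theta> z * szego z) holomorphic_on ball 0 1" by (intro holomorphic_on_mult szego_holomorphic \<Theta>_holomorphic)
  have orth: "((\<lambda>r. hardy_mean K (\<lambda>z. \<Theta> z * szego z) r) \<longlongrightarrow> 0) (at_left 1)"
    unfolding K_def by (rule model_kernel_orthogonal[OF szego_holomorphic szego_sq_mean_le])
  have "((\<lambda>r. hardy_mean K szego r - \<Theta> w * hardy_mean K (\<lambda>z. \<Theta> z * szego z) r) \<longlongrightarrow> K w - \<Theta> w * 0) (at_left 1)"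
    by (intro tendsto_diff tendsto_mult tendsto_const hardy_mean_szego_tendsto K orth)
  hence "((\<lambda>r. Re (hardy_mean K szego r - \<Theta> w * hardy_mean K (\<lambda>z. \<Theta> z * szego z) r)) \<longlongrightarrow> Re (K w - \<Theta> w * 0)) (at_left 1)"
    by (rule tendsto_Re)
  moreover have "eventually (\<lambda>r. Re (hardy_mean K szego r - \<Theta> w * hardy_mean K (\<lambda>z. \<Theta> z * szego z) r) = hardy_sq_mean K r) (at_left 1)"
    using eventually_at_left_1
  proof eventually_elim
    case (elim r)
    note cts = sphere_continuous[OF _ conjunct2[OF elim]]
    have "hardy_mean K szego r - \<Theta> w * hardy_mean K (\<lambda>z. \<Theta> z * szego z) r = hardy_mean K (\<lambda>z. szego z - cnj (\<Theta> w) * (\<Theta> z * szego z)) r"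
      using elim by (subst hardy_mean_diff_right)
        (auto intro!: cts \<Theta>szego K szego_holomorphic continuous_on_mult[OF continuous_on_const cts[OF \<Theta>szego]] simp: hardy_mean_mult_right simp del: times_divide_eq_right)
    also have "\<dots> = hardy_mean K K r" unfolding K_def model_kernel_eq ..
    also have "\<dots> = of_real (hardy_sq_mean K r)" using elim by (intro hardy_mean_self cts K) auto
    finally show ?case by simp
  qed
  moreover have "Re (K w - \<Theta> w * 0) = (1 - (norm (\<Theta> w))\<^sup>2) / (1 - (norm w)\<^sup>2)"
  proof -
    have "K w = of_real ((1 - (norm (\<Theta> w))\<^sup>2) / (1 - (norm w)\<^sup>2))"
      by (simp add: K_def model_kernel_def complex_norm_square mult.commute flip: of_real_power)
    thus ?thesis by (simp only: mult_zero_right diff_zero Re_complex_of_real)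
  qed
  ultimately show ?thesis unfolding K_def[symmetric] by (simp add: Lim_transform_eventually)
qed

lemma hardy_norm_model_kernel: "(hardy_norm (model_kernel \<Theta> w))\<^sup>2 = (1 - (norm (\<Theta> w))\<^sup>2) / (1 - (norm w)\<^sup>2)"
  and model_kernel_hardy2: "model_kernel \<Theta> w \<in> hardy2"
  using hardy_norm_eq_limit[OF model_kernel_holomorphic model_kernel_sq_mean_tendsto] by auto

lemma model_kernel_in_model_space: "model_kernel \<Theta> w \<in> model_space \<Theta>"
  unfolding model_space_def
proof (intro CollectI conjI ballI model_kernel_hardy2)
  fix h assume "h \<in> (\<lambda>g z. \<Theta> z * g z) ` hardy2"
  then obtain g where g: "g \<in> hardy2" "h = (\<lambda>z. \<Theta> z * g z)" by auto
  have "((\<lambda>r. hardy_mean (model_kernel \<Theta> w) h r) \<longlongrightarrow> 0) (at_left 1)"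
    unfolding g(2) by (rule model_kernel_orthogonal[where B = "(hardy_norm g)\<^sup>2"])
      (use g hardy2_sq_mean_le in \<open>auto simp: hardy2_def\<close>)
  thus "hardy_inner (model_kernel \<Theta> w) h = 0"
    unfolding hardy_inner_def by (intro tendsto_Lim) (auto simp: trivial_limit_at_left_real)
qed

end

lemma inner_function_norm_less_1:
  assumes "inner_function \<Theta>" "\<not> \<Theta> constant_on ball 0 1" "norm z < 1"
  shows "norm (\<Theta> z) < 1"
proof (rule ccontr)
  assume "\<not> norm (\<Theta> z) < 1"
  hence z1: "1 \<le> norm (\<Theta> z)" by simp
  have "\<Theta> constant_on ball 0 1"
  proof (rule maximum_modulus_principle[where U = "ball 0 1" and \<xi> = z])
    show "\<Theta> holomorphic_on ball 0 1" using assms by (simp add: inner_function_def)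
    show "norm (\<Theta> y) \<le> norm (\<Theta> z)" if "y \<in> ball 0 1" for y
      using assms(1) that z1 unfolding inner_function_def by (meson order_trans)
  qed (use assms in auto)
  thus False using assms by simp
qed

section \<open>Integrals against point masses\<close>

lemma nn_integral_count_space_atLeast:
  "(\<integral>\<^sup>+ k. g k \<partial>count_space {N..}) = (SUP n. \<Sum>k\<in>{N..<N+n}. g k)" for g :: "nat \<Rightarrow> ennreal"
proof -
  have b: "bij_betw (\<lambda>i. i + N) UNIV {N..}"
    by (rule bij_betwI[where g = "\<lambda>k. k - N"]) auto
  have "(\<integral>\<^sup>+ k. g k \<partial>count_space {N..}) = (\<integral>\<^sup>+ i. g (i + N) \<partial>count_space UNIV)"
    by (rule nn_integral_bij_count_space[OF b, symmetric])
  also have "\<dots> = (\<Sum>i. g (i + N))" by (rule nn_integral_count_space_nat)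
  also have "\<dots> = (SUP n. \<Sum>i<n. g (i + N))" by (rule suminf_eq_SUP)
  also have "(\<lambda>n. \<Sum>i<n. g (i + N)) = (\<lambda>n. \<Sum>k\<in>{N..<N+n}. g k)"
    using sum.shift_bounds_nat_ivl[of g 0 N] by (simp only: atLeast0LessThan add_0 add.commute[of N])
  finally show ?thesis .
qed

lemma l2_norm_sq_point_masses:
  assumes a: "\<And>k. N \<le> k \<Longrightarrow> a k \<in> ball 0 1" and f: "continuous_on (ball 0 1) f" and c: "\<And>k. N \<le> k \<Longrightarrow> 0 \<le> c k"
  shows "l2_norm_sq (point_masses c a N) f = (SUP n. ennreal (\<Sum>k\<in>{N..<N+n}. c k * (norm (f (a k)))\<^sup>2))"
proof -
  have m: "a \<in> measurable (density (count_space {N..}) (\<lambda>k. ennreal (c k))) (restrict_space borel (ball 0 1))"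
    using a by (auto simp: measurable_def space_restrict_space)
  have fm: "(\<lambda>z. ennreal ((norm (f z))\<^sup>2)) \<in> borel_measurable (restrict_space borel (ball 0 1))"
    using borel_measurable_continuous_on_restrict[OF f] by measurable
  have "l2_norm_sq (point_masses c a N) f = (\<integral>\<^sup>+ k. ennreal ((norm (f (a k)))\<^sup>2) \<partial>density (count_space {N..}) (\<lambda>k. ennreal (c k)))"
    unfolding l2_norm_sq_def point_masses_def by (rule nn_integral_distr[OF m]) (use fm in simp)
  also have "\<dots> = (\<integral>\<^sup>+ k. ennreal (c k) * ennreal ((norm (f (a k)))\<^sup>2) \<partial>count_space {N..})"
    by (rule nn_integral_density) auto
  also have "\<dots> = (SUP n. \<Sum>k\<in>{N..<N+n}. ennreal (c k) * ennreal ((norm (f (a k)))\<^sup>2))"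
    by (rule nn_integral_count_space_atLeast)
  also have "(\<lambda>n. \<Sum>k\<in>{N..<N+n}. ennreal (c k) * ennreal ((norm (f (a k)))\<^sup>2)) = (\<lambda>n. ennreal (\<Sum>k\<in>{N..<N+n}. c k * (norm (f (a k)))\<^sup>2))"
  proof
    fix n
    have "(\<Sum>k\<in>{N..<N+n}. ennreal (c k) * ennreal ((norm (f (a k)))\<^sup>2)) = (\<Sum>k\<in>{N..<N+n}. ennreal (c k * (norm (f (a k)))\<^sup>2))"
      using c by (intro sum.cong refl) (auto simp: ennreal_mult')
    also have "\<dots> = ennreal (\<Sum>k\<in>{N..<N+n}. c k * (norm (f (a k)))\<^sup>2)"
      using c by (intro sum_ennreal) auto
    finally show "(\<Sum>k\<in>{N..<N+n}. ennreal (c k) * ennreal ((norm (f (a k)))\<^sup>2)) = ennreal (\<Sum>k\<in>{N..<N+n}. c k * (norm (f (a k)))\<^sup>2)" .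
  qed
  finally show ?thesis .
qed

section \<open>Thin sequences and the two constants\<close>

definition pseudohyperbolic_defect :: "complex \<Rightarrow> complex \<Rightarrow> real" where
  "pseudohyperbolic_defect u v = (1 - (norm u)\<^sup>2) * (1 - (norm v)\<^sup>2) / (norm (1 - cnj u * v))\<^sup>2"

lemma pseudohyperbolic_sq_eq:
  assumes "norm u < 1" "norm v < 1"
  shows "(norm ((u - v) / (1 - cnj v * u)))\<^sup>2 = 1 - pseudohyperbolic_defect u v"
  using one_minus_pseudohyperbolic_sq[OF assms]
  unfolding pseudohyperbolic_defect_def norm_one_minus_cnj_mult_commute[of u v] by linarith

lemma pseudohyperbolic_defect_nonneg:
  assumes "norm u < 1" "norm v < 1"
  shows "0 \<le> pseudohyperbolic_defect u v"
  unfolding pseudohyperbolic_defect_def using assms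
  by (intro divide_nonneg_nonneg mult_nonneg_nonneg) (auto simp: power_le_one)

lemma pseudohyperbolic_le_1:
  assumes "norm u < 1" "norm v < 1"
  shows "norm ((u - v) / (1 - cnj v * u)) \<le> 1"
proof -
  have "(norm ((u - v) / (1 - cnj v * u)))\<^sup>2 \<le> 1\<^sup>2"
    using pseudohyperbolic_sq_eq[OF assms] pseudohyperbolic_defect_nonneg[OF assms] by simp
  thus ?thesis by (rule power2_le_imp_le) simp
qed

lemma pseudohyperbolic_defect_self:
  assumes "norm u < 1"
  shows "pseudohyperbolic_defect u u = 1"
proof -
  have "1 - (norm u)\<^sup>2 \<noteq> 0" using assms by (simp add: power_less_one_iff less_imp_neq)
  moreover have "norm (1 - cnj u * u) = 1 - (norm u)\<^sup>2"
  proof -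
    have "1 - cnj u * u = of_real (1 - (norm u)\<^sup>2)" by (simp add: complex_norm_square mult.commute flip: of_real_power)
    thus ?thesis using assms by (simp only: norm_of_real) (simp add: power_le_one)
  qed
  ultimately show ?thesis by (simp add: pseudohyperbolic_defect_def power2_eq_square)
qed

lemma pseudohyperbolic_defect_ge:
  assumes "norm u < 1" "norm v < 1"
  shows "(1 - (norm u)\<^sup>2) / 4 * (1 - (norm v)\<^sup>2) \<le> pseudohyperbolic_defect u v"
proof -
  have "norm (cnj u * v) \<le> 1" using assms by (simp add: norm_mult mult_le_one)
  hence "norm (1 - cnj u * v) \<le> 2" using norm_triangle_ineq4[of 1 "cnj u * v"] by simp
  hence "(norm (1 - cnj u * v))\<^sup>2 \<le> 2\<^sup>2" by (intro power_mono) auto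
  moreover have "0 < norm (1 - cnj u * v)" using one_minus_cnj_mult_nonzero[of u v] assms by simp
  moreover have "0 \<le> (1 - (norm u)\<^sup>2) * (1 - (norm v)\<^sup>2)" using assms by (simp add: power_le_one)
  ultimately have "(1 - (norm u)\<^sup>2) * (1 - (norm v)\<^sup>2) / 4 \<le> pseudohyperbolic_defect u v"
    unfolding pseudohyperbolic_defect_def by (intro divide_left_mono) auto
  thus ?thesis by simp
qed

lemma pseudohyperbolic_defect_le:
  assumes "norm u < 1" "norm v < 1"
  shows "pseudohyperbolic_defect u v \<le> (1 - (norm u)\<^sup>2) / (1 - norm v)\<^sup>2"
proof -
  have "1 - norm v \<le> norm (1 - cnj u * v)" using norm_one_minus_cnj_mult_ge[of v u] assms by simp
  hence "(1 - norm v)\<^sup>2 \<le> (norm (1 - cnj u * v))\<^sup>2" using assms by (intro power_mono) auto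
  moreover have "(1 - (norm u)\<^sup>2) * (1 - (norm v)\<^sup>2) \<le> 1 - (norm u)\<^sup>2"
    using assms by (intro mult_left_le) (auto simp: power_le_one)
  ultimately show ?thesis unfolding pseudohyperbolic_defect_def using assms
    by (intro frac_le) (auto simp: power_le_one)
qed

lemma prod_subset_le:
  fixes f :: "'i \<Rightarrow> real"
  assumes "finite B" "A \<subseteq> B" "\<And>i. i \<in> B \<Longrightarrow> 0 \<le> f i \<and> f i \<le> 1"
  shows "prod f B \<le> prod f A"
proof -
  have "prod f B = prod f (B - A) * prod f A" by (rule prod.subset_diff[OF assms(2,1)])
  also have "\<dots> \<le> 1 * prod f A"
    using assms by (intro mult_right_mono prod_le_1 prod_nonneg) auto
  finally show ?thesis by simp
qed

text \<open>
  The partial products decrease, so the thinness product exists and bounds all of its finite parts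
  from below.
\<close>

lemma lim_partial_products:
  fixes a :: "nat \<Rightarrow> complex"
  assumes a: "\<And>n. 1 \<le> n \<Longrightarrow> norm (a n) < 1" and j: "1 \<le> j"
  defines "X \<equiv> \<lambda>n. \<Prod>k\<in>{1..n} - {j}. norm ((a j - a k) / (1 - cnj (a k) * a j))"
  shows "X \<longlonglongrightarrow> lim X" "lim X \<le> X n"
proof -
  have f: "0 \<le> norm ((a j - a k) / (1 - cnj (a k) * a j)) \<and> norm ((a j - a k) / (1 - cnj (a k) * a j)) \<le> 1" if "1 \<le> k" for k
    using pseudohyperbolic_le_1[OF a[OF j] a[OF that]] by simp
  have "decseq X" unfolding X_def decseq_def by (intro allI impI prod_subset_le f) auto
  moreover have "\<forall>n. 0 \<le> X n" unfolding X_def by (intro allI prod_nonneg) auto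
  ultimately obtain L where L: "X \<longlonglongrightarrow> L" "\<forall>n. L \<le> X n" by (rule decseq_convergent)
  thus "X \<longlonglongrightarrow> lim X" "lim X \<le> X n" by (auto simp: limI)
qed

context
  fixes a :: "nat \<Rightarrow> complex" and \<Theta> :: "complex \<Rightarrow> complex"
  assumes disc: "\<And>n. 1 \<le> n \<Longrightarrow> norm (a n) < 1" and inner: "inner_function \<Theta>"
    and nonconst: "\<not> \<Theta> constant_on ball 0 1"
begin

abbreviation (input) "mass n \<equiv> (1 - (norm (a n))\<^sup>2) / (1 - (norm (\<Theta> (a n)))\<^sup>2)"
abbreviation (input) "\<rho> n k \<equiv> norm ((a n - a k) / (1 - cnj (a k) * a n))"

lemma \<Theta>_less_1: "norm z < 1 \<Longrightarrow> norm (\<Theta> z) < 1"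
  by (rule inner_function_norm_less_1[OF inner nonconst])

lemma mass_pos: "1 \<le> n \<Longrightarrow> 0 < mass n"
  using disc \<Theta>_less_1[OF disc] by (simp add: power_less_one_iff)

lemma sigma_measure_eq:
  assumes "1 \<le> N"
  shows "sigma_measure \<Theta> a N = point_masses (\<lambda>n. mass n) a N"
proof -
  have "1 / (hardy_norm (model_kernel \<Theta> (a k)))\<^sup>2 = mass k" if "N \<le> k" for k
    using hardy_norm_model_kernel[OF inner disc, of k] assms that by simp
  hence "density (count_space {N..}) (\<lambda>k. ennreal (1 / (hardy_norm (model_kernel \<Theta> (a k)))\<^sup>2)) =
     density (count_space {N..}) (\<lambda>k. ennreal (mass k))"
    by (intro density_cong) (auto simp: AE_count_space)
  thus ?thesis unfolding sigma_measure_def point_masses_def by simp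
qed

lemma l2_norm_sq_sigma_measure:
  assumes N: "1 \<le> N" and f: "f holomorphic_on ball 0 1"
  shows "l2_norm_sq (sigma_measure \<Theta> a N) f = (SUP n. ennreal (\<Sum>k\<in>{N..<N+n}. mass k * (norm (f (a k)))\<^sup>2))"
  unfolding sigma_measure_eq[OF N]
  by (rule l2_norm_sq_point_masses[OF _ holomorphic_on_imp_continuous_on[OF f]])
     (use N disc less_imp_le[OF mass_pos] in auto)

lemma normalized_model_kernel_holomorphic:
  "norm z < 1 \<Longrightarrow> normalized_model_kernel \<Theta> z holomorphic_on ball 0 1"
  unfolding normalized_model_kernel_def[abs_def] by (intro holomorphic_on_mult holomorphic_on_const model_kernel_holomorphic[OF inner])

lemma norm_normalized_model_kernel:
  assumes "norm z < 1"
  shows "(norm (normalized_model_kernel \<Theta> z v))\<^sup>2 =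
    (1 - (norm z)\<^sup>2) / (1 - (norm (\<Theta> z))\<^sup>2) * (norm (model_kernel \<Theta> z v))\<^sup>2"
proof -
  have "0 \<le> (1 - (norm z)\<^sup>2) / (1 - (norm (\<Theta> z))\<^sup>2)"
    using assms less_imp_le[OF \<Theta>_less_1[OF assms]] by (intro divide_nonneg_nonneg) (auto simp: power_le_one)
  thus ?thesis unfolding normalized_model_kernel_def norm_mult power_mult_distrib norm_of_real power2_abs by simp
qed

text \<open>
  The left side is the same expression for $H^2$, where $\Theta = 0$. The quotient of the two is
  $1/(1-\rho(\Theta(\lambda_n),\Theta(\lambda_k))^2) \ge 1$.
\<close>

lemma defect_le_normalized_model_kernel:
  assumes n: "1 \<le> n" and k: "1 \<le> k"
  shows "pseudohyperbolic_defect (a n) (a k) \<le> mass k * (norm (normalized_model_kernel \<Theta> (a n) (a k)))\<^sup>2"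
proof -
  define d where "d = norm (1 - cnj (a n) * a k)"
  define D where "D = norm (1 - cnj (\<Theta> (a n)) * \<Theta> (a k))"
  define p q P Q where pq: "p = 1 - (norm (a n))\<^sup>2" "q = 1 - (norm (a k))\<^sup>2"
    "P = 1 - (norm (\<Theta> (a n)))\<^sup>2" "Q = 1 - (norm (\<Theta> (a k)))\<^sup>2"
  note n\<Theta> = \<Theta>_less_1[OF disc[OF n]] and k\<Theta> = \<Theta>_less_1[OF disc[OF k]]
  have pos: "0 < p" "0 < q" "0 < P" "0 < Q" unfolding pq
    using disc[OF n] disc[OF k] n\<Theta> k\<Theta> by (auto simp: power_less_one_iff)
  have d: "0 < d" unfolding d_def using one_minus_cnj_mult_nonzero[OF disc[OF n]] disc[OF k] by simp
  have D: "0 < D" unfolding D_def using one_minus_cnj_mult_nonzero[OF n\<Theta>] k\<Theta> by simp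
  have "pseudohyperbolic_defect (\<Theta> (a n)) (\<Theta> (a k)) \<le> 1"
    using pseudohyperbolic_sq_eq[OF n\<Theta> k\<Theta>] by (metis diff_ge_0_iff_ge zero_le_power2)
  hence PQ: "P * Q \<le> D\<^sup>2" using D unfolding pseudohyperbolic_defect_def D_def[symmetric] pq[symmetric]
    by (simp add: pos_divide_le_eq)
  have "pseudohyperbolic_defect (a n) (a k) = p * q / d\<^sup>2"
    by (simp add: pseudohyperbolic_defect_def pq d_def)
  also have "\<dots> \<le> p * q / d\<^sup>2 * (D\<^sup>2 / (P * Q))"
  proof -
    have "1 \<le> D\<^sup>2 / (P * Q)" using PQ pos by (simp add: pos_le_divide_eq)
    moreover have "0 \<le> p * q / d\<^sup>2" using pos by simp
    ultimately have "p * q / d\<^sup>2 * 1 \<le> p * q / d\<^sup>2 * (D\<^sup>2 / (P * Q))" by (rule mult_left_mono)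
    thus ?thesis by simp
  qed
  also have "\<dots> = (q / Q) * (p / P * (D / d)\<^sup>2)" by (simp add: power_divide mult_ac)
  also have "\<dots> = mass k * (norm (normalized_model_kernel \<Theta> (a n) (a k)))\<^sup>2"
    unfolding norm_normalized_model_kernel[OF disc[OF n]] by (simp add: model_kernel_def norm_divide pq d_def D_def)
  finally show ?thesis .
qed

lemma defect_sum_le_reproducing_const:
  assumes "1 \<le> N" "N \<le> n"
  shows "ennreal (\<Sum>k\<in>{N..<N+m}. pseudohyperbolic_defect (a n) (a k)) \<le> reproducing_const \<Theta> (sigma_measure \<Theta> a N)"
proof -
  have n: "1 \<le> n" using assms by simp
  have "ennreal (\<Sum>k\<in>{N..<N+m}. pseudohyperbolic_defect (a n) (a k))
     \<le> ennreal (\<Sum>k\<in>{N..<N+m}. mass k * (norm (normalized_model_kernel \<Theta> (a n) (a k)))\<^sup>2)"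
    using assms n by (intro ennreal_leI sum_mono defect_le_normalized_model_kernel) auto
  also have "\<dots> \<le> l2_norm_sq (sigma_measure \<Theta> a N) (normalized_model_kernel \<Theta> (a n))"
    unfolding l2_norm_sq_sigma_measure[OF assms(1) normalized_model_kernel_holomorphic[OF disc[OF n]]]
    by (rule SUP_upper) simp
  also have "\<dots> \<le> reproducing_const \<Theta> (sigma_measure \<Theta> a N)"
    unfolding reproducing_const_def by (rule SUP_upper) (use disc[OF n] in simp)
  finally show ?thesis .
qed

lemma one_le_reproducing_const:
  assumes "1 \<le> N" shows "1 \<le> reproducing_const \<Theta> (sigma_measure \<Theta> a N)"
  using defect_sum_le_reproducing_const[OF assms order_refl, of 1] pseudohyperbolic_defect_self[OF disc[OF assms]]
  by simp

lemma reproducing_const_le_carleson_const: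
  assumes N: "1 \<le> N"
  shows "reproducing_const \<Theta> (sigma_measure \<Theta> a N) \<le> carleson_const \<Theta> (sigma_measure \<Theta> a N)"
  unfolding reproducing_const_def
proof (rule SUP_least)
  fix z :: complex assume "z \<in> ball 0 1"
  hence z: "norm z < 1" by simp
  define K where "K = model_kernel \<Theta> z"
  define s where "s = (1 - (norm (\<Theta> z))\<^sup>2) / (1 - (norm z)\<^sup>2)"
  have s: "0 < s" unfolding s_def using z \<Theta>_less_1[OF z] by (simp add: power_less_one_iff)
  have Ks: "(hardy_norm K)\<^sup>2 = s" unfolding K_def s_def by (rule hardy_norm_model_kernel[OF inner z])
  have Kz: "K z \<noteq> 0"
  proof -
    have "K z = of_real s"
      by (simp add: K_def s_def model_kernel_def complex_norm_square mult.commute flip: of_real_power)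
    thus ?thesis using s by simp
  qed
  have "l2_norm_sq (sigma_measure \<Theta> a N) (normalized_model_kernel \<Theta> z) \<le> l2_norm_sq (sigma_measure \<Theta> a N) K / ennreal s"
    unfolding l2_norm_sq_sigma_measure[OF N normalized_model_kernel_holomorphic[OF z]]
  proof (rule SUP_least)
    fix n
    have nonneg: "0 \<le> (\<Sum>k\<in>{N..<N+n}. mass k * (norm (K (a k)))\<^sup>2)"
      by (intro sum_nonneg mult_nonneg_nonneg less_imp_le[OF mass_pos] zero_le_power2) (use N in auto)
    have "(\<Sum>k\<in>{N..<N+n}. mass k * (norm (normalized_model_kernel \<Theta> z (a k)))\<^sup>2) = (\<Sum>k\<in>{N..<N+n}. mass k * (norm (K (a k)))\<^sup>2) / s"
      unfolding sum_divide_distrib norm_normalized_model_kernel[OF z] K_def s_def by (intro sum.cong refl) simp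
    hence "ennreal (\<Sum>k\<in>{N..<N+n}. mass k * (norm (normalized_model_kernel \<Theta> z (a k)))\<^sup>2)
        = ennreal (\<Sum>k\<in>{N..<N+n}. mass k * (norm (K (a k)))\<^sup>2) / ennreal s"
      by (simp only: divide_ennreal[OF nonneg s])
    also have "\<dots> \<le> l2_norm_sq (sigma_measure \<Theta> a N) K / ennreal s"
      unfolding l2_norm_sq_sigma_measure[OF N model_kernel_holomorphic[OF inner z, folded K_def]]
      by (intro divide_right_mono_ennreal SUP_upper) simp
    finally show "ennreal (\<Sum>k\<in>{N..<N+n}. mass k * (norm (normalized_model_kernel \<Theta> z (a k)))\<^sup>2) \<le> l2_norm_sq (sigma_measure \<Theta> a N) K / ennreal s" .
  qed
  also have "\<dots> \<le> carleson_const \<Theta> (sigma_measure \<Theta> a N)"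
    unfolding carleson_const_def Ks[symmetric]
    by (rule SUP_upper) (use model_kernel_in_model_space[OF inner z] Kz z in \<open>auto simp: K_def\<close>)
  finally show "l2_norm_sq (sigma_measure \<Theta> a N) (normalized_model_kernel \<Theta> z) \<le> carleson_const \<Theta> (sigma_measure \<Theta> a N)" .
qed

text \<open>
  Far enough out, thinness bounds the products over all finite parts of the tail, and by
  $1-\rho^2 \ge \frac14 w_j^2 w_k^2$ it also makes the sequence a Blaschke sequence, so the tails of
  $\sum_k w_k^2$ are small too. The factor $1/(1-e)$ accounts for the replacement of the weights
  $w_k^2/(1-|\Theta(\lambda_k)|^2)$ by $w_k^2$.
\<close>

lemma carleson_const_le_of_thin:
  assumes thin: "thin_sequence a" and small: "(\<lambda>n. norm (\<Theta> (a n))) \<longlonglongrightarrow> 0" and \<tau>: "1 < \<tau>"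
  shows "eventually (\<lambda>N. carleson_const \<Theta> (sigma_measure \<Theta> a N) \<le> ennreal \<tau>) sequentially"
proof -
  have "((\<lambda>e. thin_carleson_bound e / (1 - e)) \<longlongrightarrow> 1 / (1 - 0)) (at_right 0)"
    by (intro tendsto_intros thin_carleson_bound_tendsto) auto
  hence "eventually (\<lambda>e. thin_carleson_bound e / (1 - e) < \<tau>) (at_right 0)"
    using \<tau> by (intro order_tendstoD(2)) auto
  moreover have "eventually (\<lambda>e. e \<in> {0<..<1::real}) (at_right 0)" by (rule eventually_at_right_real) simp
  ultimately have "eventually (\<lambda>e. thin_carleson_bound e / (1 - e) < \<tau> \<and> e \<in> {0<..<1}) (at_right 0)"
    by (rule eventually_conj)
  then obtain e where e: "thin_carleson_bound e / (1 - e) < \<tau>" "0 < e" "e < 1"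
    using eventually_happens'[OF trivial_limit_at_right_real] by auto
  define X where "X j n = (\<Prod>k\<in>{1..n} - {j}. \<rho> j k)" for j n
  have "(\<lambda>j. lim (X j)) \<longlonglongrightarrow> 1" using thin by (simp add: thin_sequence_def X_def[abs_def])
  moreover have "1 / sqrt (1 + e) < 1" using e by simp
  ultimately have "eventually (\<lambda>j. 1 / sqrt (1 + e) < lim (X j)) sequentially" by (rule order_tendstoD(1))
  then obtain j0 where j0: "\<And>j. j0 \<le> j \<Longrightarrow> 1 / sqrt (1 + e) < lim (X j)" by (auto simp: eventually_sequentially)
  define N0 where "N0 = max j0 1"
  have prods: "1 / (1 + e) \<le> (\<Prod>k\<in>{N..<M} - {j}. \<rho> j k)\<^sup>2" if N: "N0 \<le> N" and j: "j \<in> {N..<M}" for N M j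
  proof -
    have j1: "1 \<le> j" "j0 \<le> j" using N j by (auto simp: N0_def)
    have "1 / sqrt (1 + e) \<le> lim (X j)" using j0[OF j1(2)] by simp
    also have "\<dots> \<le> X j M" unfolding X_def by (rule lim_partial_products(2)[OF disc j1(1)])
    also have "\<dots> \<le> (\<Prod>k\<in>{N..<M} - {j}. \<rho> j k)" unfolding X_def
      using N pseudohyperbolic_le_1[OF disc[OF j1(1)] disc] by (intro prod_subset_le) (auto simp: N0_def)
    finally have "(1 / sqrt (1 + e))\<^sup>2 \<le> (\<Prod>k\<in>{N..<M} - {j}. \<rho> j k)\<^sup>2"
      using e by (intro power_mono) auto
    thus ?thesis using e by (simp add: power_divide)
  qed
  have disc': "norm (a k) < 1" if "N0 \<le> k" for k using disc that by (simp add: N0_def)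
  have "summable (\<lambda>k. 1 - (norm (a (k + N0)))\<^sup>2)"
  proof (rule bounded_imp_summable)
    show "0 \<le> 1 - (norm (a (n + N0)))\<^sup>2" for n using disc'[of "n + N0"] by (simp add: power_le_one)
    show "(\<Sum>k\<le>n. 1 - (norm (a (k + N0)))\<^sup>2) \<le> 1 + 4 * e / (1 - (norm (a N0))\<^sup>2)" for n
    proof -
      define W where "W = 1 - (norm (a N0))\<^sup>2"
      have W: "0 < W" using disc'[of N0] by (simp add: W_def power_less_one_iff)
      define I where "I = {N0..<N0 + Suc n}"
      have I: "N0 \<in> I" "finite I" by (auto simp: I_def)
      have "W / 4 * (\<Sum>k\<in>I-{N0}. 1 - (norm (a k))\<^sup>2) \<le> (\<Sum>k\<in>I-{N0}. pseudohyperbolic_defect (a N0) (a k))"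
        unfolding sum_distrib_left W_def by (intro sum_mono pseudohyperbolic_defect_ge disc') (auto simp: I_def)
      also have "\<dots> \<le> e"
        unfolding pseudohyperbolic_defect_def
        by (rule sum_le_of_pseudohyperbolic_prod_ge[of I a]) (use I prods disc' e in \<open>auto simp: I_def\<close>)
      finally have le: "(\<Sum>k\<in>I-{N0}. 1 - (norm (a k))\<^sup>2) \<le> 4 * e / W" using W by (simp add: field_simps)
      have "(\<Sum>k\<le>n. 1 - (norm (a (k + N0)))\<^sup>2) = (\<Sum>k\<in>I. 1 - (norm (a k))\<^sup>2)"
        unfolding I_def using sum.shift_bounds_nat_ivl[of "\<lambda>k. 1 - (norm (a k))\<^sup>2" 0 N0 "Suc n"]
        by (simp only: atLeast0LessThan add_0 add.commute[of N0] lessThan_Suc_atMost)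
      also have "\<dots> = (1 - (norm (a N0))\<^sup>2) + (\<Sum>k\<in>I-{N0}. 1 - (norm (a k))\<^sup>2)"
        using I by (rule sum.remove[rotated])
      also have "\<dots> \<le> 1 + 4 * e / W" using le by (intro add_mono) auto
      finally show ?thesis by (simp add: W_def)
    qed
  qed
  hence "summable (\<lambda>k. 1 - (norm (a k))\<^sup>2)" by (rule summable_iff_shift[THEN iffD1])
  then obtain N1 where N1: "\<And>m n. N1 \<le> m \<Longrightarrow> norm (\<Sum>k\<in>{m..<n}. 1 - (norm (a k))\<^sup>2) < e"
    unfolding summable_Cauchy using e(2) by meson
  have "eventually (\<lambda>n. norm (\<Theta> (a n)) < sqrt e) sequentially"
    using small e(2) by (intro order_tendstoD(2)) auto
  then obtain N2 where N2: "\<And>n. N2 \<le> n \<Longrightarrow> norm (\<Theta> (a n)) < sqrt e" by (auto simp: eventually_sequentially)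
  show ?thesis unfolding eventually_sequentially
  proof (intro exI allI impI)
    fix N assume "max N0 (max N1 N2) \<le> N"
    hence N: "N0 \<le> N" "N1 \<le> N" "N2 \<le> N" "1 \<le> N" by (auto simp: N0_def)
    show "carleson_const \<Theta> (sigma_measure \<Theta> a N) \<le> ennreal \<tau>"
      unfolding carleson_const_def
    proof (rule SUP_least)
      fix f assume "f \<in> {f \<in> model_space \<Theta>. \<exists>z\<in>ball 0 1. f z \<noteq> 0}"
      then obtain z where f: "f \<in> hardy2" and z: "norm z < 1" "f z \<noteq> 0" by (auto simp: model_space_def)
      have hol: "f holomorphic_on ball 0 1" using f by (simp add: hardy2_def)
      have pos: "0 < (hardy_norm f)\<^sup>2" by (rule hardy_norm_pos[OF f z])
      have "l2_norm_sq (sigma_measure \<Theta> a N) f \<le> ennreal (\<tau> * (hardy_norm f)\<^sup>2)"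
        unfolding l2_norm_sq_sigma_measure[OF N(4) hol]
      proof (rule SUP_least, rule ennreal_leI)
        fix n
        have "(\<Sum>k\<in>{N..<N+n}. mass k * (norm (f (a k)))\<^sup>2) \<le> (\<Sum>k\<in>{N..<N+n}. ((1 - (norm (a k))\<^sup>2) * (norm (f (a k)))\<^sup>2) / (1 - e))"
        proof (rule sum_mono)
          fix k assume k: "k \<in> {N..<N+n}"
          have "(norm (\<Theta> (a k)))\<^sup>2 \<le> (sqrt e)\<^sup>2" using N2[of k] k N by (intro power_mono) auto
          hence "1 - e \<le> 1 - (norm (\<Theta> (a k)))\<^sup>2" using e by simp
          moreover have "0 \<le> 1 - (norm (a k))\<^sup>2" using disc'[of k] k N by (simp add: power_le_one)
          ultimately have "mass k \<le> (1 - (norm (a k))\<^sup>2) / (1 - e)" using e by (intro divide_left_mono) auto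
          hence "mass k * (norm (f (a k)))\<^sup>2 \<le> (1 - (norm (a k))\<^sup>2) / (1 - e) * (norm (f (a k)))\<^sup>2" by (rule mult_right_mono) simp
          thus "mass k * (norm (f (a k)))\<^sup>2 \<le> ((1 - (norm (a k))\<^sup>2) * (norm (f (a k)))\<^sup>2) / (1 - e)" by simp
        qed
        also have "\<dots> = (\<Sum>k\<in>{N..<N+n}. (1 - (norm (a k))\<^sup>2) * (norm (f (a k)))\<^sup>2) / (1 - e)"
          by (rule sum_divide_distrib[symmetric])
        also have "\<dots> \<le> (thin_carleson_bound e * (hardy_norm f)\<^sup>2) / (1 - e)"
        proof (rule divide_right_mono)
          have "(\<Sum>k\<in>{N..<N+n}. 1 - (norm (a k))\<^sup>2) \<le> e" using N1[OF N(2), of "N + n"] by simp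
          thus "(\<Sum>k\<in>{N..<N+n}. (1 - (norm (a k))\<^sup>2) * (norm (f (a k)))\<^sup>2) \<le> thin_carleson_bound e * (hardy_norm f)\<^sup>2"
            using e N disc' by (intro hardy2_finite_carleson_embedding prods f) auto
        qed (use e in simp)
        also have "\<dots> = thin_carleson_bound e / (1 - e) * (hardy_norm f)\<^sup>2" by simp
        also have "\<dots> \<le> \<tau> * (hardy_norm f)\<^sup>2" using e by (intro mult_right_mono) auto
        finally show "(\<Sum>k\<in>{N..<N+n}. mass k * (norm (f (a k)))\<^sup>2) \<le> \<tau> * (hardy_norm f)\<^sup>2" .
      qed
      also have "ennreal (\<tau> * (hardy_norm f)\<^sup>2) = ennreal ((hardy_norm f)\<^sup>2) * ennreal \<tau>"
        using \<tau> by (simp add: ennreal_mult' mult.commute)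
      finally show "l2_norm_sq (sigma_measure \<Theta> a N) f / ennreal ((hardy_norm f)\<^sup>2) \<le> ennreal \<tau>"
        using pos by (intro divide_le_posI_ennreal) auto
    qed
  qed
qed

text \<open>
  Testing at $\lambda_n$ bounds $1 + \sum_{k \ge N, k \ne n} (1-\rho(\lambda_k,\lambda_n)^2)$, the 1
  being the term $k = n$. The Weierstrass inequality $\prod (1-x_k) \ge 1-\sum x_k$ gives the
  factors with $k \ge N$. Those with $k < N$ tend to 1 because $|\lambda_n| \to 1$.
\<close>

lemma thin_of_reproducing_const:
  assumes R: "(\<lambda>N. reproducing_const \<Theta> (sigma_measure \<Theta> a N)) \<longlonglongrightarrow> 1"
  shows "thin_sequence a"
proof -
  have sums: "\<exists>N\<ge>1. \<forall>n\<ge>N. \<forall>m. (\<Sum>k\<in>{N..<N+m}. pseudohyperbolic_defect (a n) (a k)) \<le> 1 + e" if e: "0 < e" for e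
  proof -
    have "ennreal 1 < ennreal (1 + e)" using e by (subst ennreal_less_iff) auto
    hence "1 < ennreal (1 + e)" by simp
    hence "eventually (\<lambda>N. reproducing_const \<Theta> (sigma_measure \<Theta> a N) < ennreal (1 + e)) sequentially"
      by (rule order_tendstoD(2)[OF R])
    hence "eventually (\<lambda>N. reproducing_const \<Theta> (sigma_measure \<Theta> a N) < ennreal (1 + e) \<and> 1 \<le> N) sequentially"
      using eventually_ge_at_top[of 1] by (rule eventually_conj)
    from eventually_happens'[OF sequentially_bot this]
    obtain N where N: "reproducing_const \<Theta> (sigma_measure \<Theta> a N) < ennreal (1 + e)" "1 \<le> N"
      by blast
    have "(\<Sum>k\<in>{N..<N+m}. pseudohyperbolic_defect (a n) (a k)) \<le> 1 + e" if "N \<le> n" for n m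
    proof -
      have "ennreal (\<Sum>k\<in>{N..<N+m}. pseudohyperbolic_defect (a n) (a k)) \<le> ennreal (1 + e)"
        using order_trans[OF defect_sum_le_reproducing_const[OF N(2) that] less_imp_le[OF N(1)]] .
      moreover have "0 \<le> 1 + e" using e by simp
      ultimately show ?thesis using ennreal_le_iff by blast
    qed
    thus ?thesis using N(2) by blast
  qed
  have a_lim: "(\<lambda>n. 1 - (norm (a n))\<^sup>2) \<longlonglongrightarrow> 0"
  proof -
    obtain N where N: "1 \<le> N" and s: "\<And>n m. N \<le> n \<Longrightarrow> (\<Sum>k\<in>{N..<N+m}. pseudohyperbolic_defect (a n) (a k)) \<le> 1 + 1"
      using sums[OF zero_less_one] by blast
    define W where "W = 1 - (norm (a N))\<^sup>2"
    have W: "0 < W" using disc[OF N] by (simp add: W_def power_less_one_iff)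
    have "summable (\<lambda>k. 1 - (norm (a (k + N)))\<^sup>2)"
    proof (rule bounded_imp_summable)
      show "0 \<le> 1 - (norm (a (n + N)))\<^sup>2" for n using disc[of "n + N"] N by (simp add: power_le_one)
      show "(\<Sum>k\<le>n. 1 - (norm (a (k + N)))\<^sup>2) \<le> 8 / W" for n
      proof -
        have "W / 4 * (\<Sum>k\<in>{N..<N+Suc n}. 1 - (norm (a k))\<^sup>2) \<le> (\<Sum>k\<in>{N..<N+Suc n}. pseudohyperbolic_defect (a N) (a k))"
          unfolding sum_distrib_left W_def using N by (intro sum_mono pseudohyperbolic_defect_ge disc) auto
        also have "\<dots> \<le> 2" using s[of N "Suc n"] by simp
        finally have "(\<Sum>k\<in>{N..<N+Suc n}. 1 - (norm (a k))\<^sup>2) \<le> 8 / W" using W by (simp add: field_simps)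
        moreover have "(\<Sum>k\<le>n. 1 - (norm (a (k + N)))\<^sup>2) = (\<Sum>k\<in>{N..<N+Suc n}. 1 - (norm (a k))\<^sup>2)"
          using sum.shift_bounds_nat_ivl[of "\<lambda>k. 1 - (norm (a k))\<^sup>2" 0 N "Suc n"]
          by (simp only: atLeast0LessThan add_0 add.commute[of N] lessThan_Suc_atMost)
        ultimately show ?thesis by simp
      qed
    qed
    from summable_LIMSEQ_zero[OF this] show ?thesis by (rule LIMSEQ_offset)
  qed
  define X where "X j n = (\<Prod>k\<in>{1..n} - {j}. \<rho> j k)" for j n
  have near: "eventually (\<lambda>j. 1 - e \<le> lim (X j) \<and> lim (X j) \<le> 1) sequentially" if e: "0 < e" "e < 1" for e
  proof -
    obtain N where N: "1 \<le> N" and s: "\<And>n m. N \<le> n \<Longrightarrow> (\<Sum>k\<in>{N..<N+m}. pseudohyperbolic_defect (a n) (a k)) \<le> 1 + e"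
      using sums[OF e(1)] by blast
    have prod_lim: "(\<lambda>j. \<Prod>k\<in>{1..<N}. 1 - pseudohyperbolic_defect (a j) (a k)) \<longlonglongrightarrow> (\<Prod>k\<in>{1..<N}. 1 - 0)"
    proof (rule tendsto_prod, rule tendsto_diff[OF tendsto_const])
      fix k assume k: "k \<in> {1..<N}"
      have ak: "norm (a k) < 1" using disc k by simp
      hence "(1 - norm (a k))\<^sup>2 \<noteq> 0" by simp
      from tendsto_divide[OF a_lim tendsto_const this]
      have upper: "(\<lambda>j. (1 - (norm (a j))\<^sup>2) / (1 - norm (a k))\<^sup>2) \<longlonglongrightarrow> 0" by simp
      show "(\<lambda>j. pseudohyperbolic_defect (a j) (a k)) \<longlonglongrightarrow> 0"
      proof (rule tendsto_sandwich[OF _ _ tendsto_const upper])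
        show "eventually (\<lambda>j. 0 \<le> pseudohyperbolic_defect (a j) (a k)) sequentially"
          using eventually_ge_at_top[of 1] by eventually_elim (rule pseudohyperbolic_defect_nonneg[OF disc ak])
        show "eventually (\<lambda>j. pseudohyperbolic_defect (a j) (a k) \<le> (1 - (norm (a j))\<^sup>2) / (1 - norm (a k))\<^sup>2) sequentially"
          using eventually_ge_at_top[of 1] by eventually_elim (rule pseudohyperbolic_defect_le[OF disc ak])
      qed
    qed
    have "eventually (\<lambda>j. 1 - e < (\<Prod>k\<in>{1..<N}. 1 - pseudohyperbolic_defect (a j) (a k))) sequentially"
      by (rule order_tendstoD(1)[OF prod_lim]) (use e in simp)
    thus ?thesis using eventually_ge_at_top[of N]
    proof eventually_elim
      case (elim j)
      have j: "1 \<le> j" using elim N by simp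
      have lower: "1 - e \<le> X j (N + m)" if m: "j \<le> N + m" for m
      proof -
        have rho: "(\<rho> j k)\<^sup>2 = 1 - pseudohyperbolic_defect (a j) (a k)" if "1 \<le> k" for k
          using pseudohyperbolic_sq_eq[OF disc[OF j] disc[OF that]] .
        have defect: "pseudohyperbolic_defect (a j) (a k) \<in> {0..1}" if "1 \<le> k" for k
        proof -
          have "0 \<le> (\<rho> j k)\<^sup>2" by simp
          thus ?thesis using rho[OF that] pseudohyperbolic_defect_nonneg[OF disc[OF j] disc[OF that]] by simp
        qed
        have "(X j (N + m))\<^sup>2 = (\<Prod>k\<in>{1..N + m} - {j}. (\<rho> j k)\<^sup>2)" unfolding X_def by (rule prod_power_distrib)
        also have "\<dots> = (\<Prod>k\<in>{1..N + m} - {j}. 1 - pseudohyperbolic_defect (a j) (a k))"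
          using rho by (intro prod.cong) auto
        also have "{1..N + m} - {j} = {1..<N} \<union> ({N..<N + Suc m} - {j})" using elim N by auto
        also have "(\<Prod>k\<in>\<dots>. 1 - pseudohyperbolic_defect (a j) (a k))
          = (\<Prod>k\<in>{1..<N}. 1 - pseudohyperbolic_defect (a j) (a k)) * (\<Prod>k\<in>{N..<N + Suc m} - {j}. 1 - pseudohyperbolic_defect (a j) (a k))"
          by (rule prod.union_disjoint) auto
        finally have split: "(X j (N + m))\<^sup>2 = \<dots>" .
        have "(1 - e) * (1 - e) \<le> (\<Prod>k\<in>{1..<N}. 1 - pseudohyperbolic_defect (a j) (a k)) * (\<Prod>k\<in>{N..<N + Suc m} - {j}. 1 - pseudohyperbolic_defect (a j) (a k))"
        proof (rule mult_mono)
          have "(\<Sum>k\<in>{N..<N + Suc m}. pseudohyperbolic_defect (a j) (a k)) = 1 + (\<Sum>k\<in>{N..<N + Suc m} - {j}. pseudohyperbolic_defect (a j) (a k))"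
            using elim m by (subst sum.remove[of _ j]) (auto simp: pseudohyperbolic_defect_self[OF disc[OF j]])
          hence "1 - e \<le> 1 - (\<Sum>k\<in>{N..<N + Suc m} - {j}. pseudohyperbolic_defect (a j) (a k))"
            using s[of j "Suc m"] elim by simp
          also have "\<dots> \<le> (\<Prod>k\<in>{N..<N + Suc m} - {j}. 1 - pseudohyperbolic_defect (a j) (a k))"
            by (rule Weierstrass_prod_ineq) (use defect N in auto)
          finally show "1 - e \<le> (\<Prod>k\<in>{N..<N + Suc m} - {j}. 1 - pseudohyperbolic_defect (a j) (a k))" .
          show "0 \<le> (\<Prod>k\<in>{1..<N}. 1 - pseudohyperbolic_defect (a j) (a k))" by (intro prod_nonneg) (use defect in auto)
        qed (use elim e in auto)
        hence "(1 - e)\<^sup>2 \<le> (X j (N + m))\<^sup>2" unfolding split by (simp add: power2_eq_square)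
        thus ?thesis by (rule power2_le_imp_le) (simp add: X_def prod_nonneg)
      qed
      have Xj: "X j = (\<lambda>n. \<Prod>k\<in>{1..n} - {j}. \<rho> j k)" by (simp add: X_def fun_eq_iff)
      have conv: "X j \<longlonglongrightarrow> lim (X j)"
        unfolding Xj by (rule lim_partial_products(1)[OF disc j])
      have upper: "lim (X j) \<le> X j 0"
        unfolding Xj by (rule lim_partial_products(2)[OF disc j])
      have "1 - e \<le> lim (X j)"
      proof (rule tendsto_lowerbound[OF conv])
        show "eventually (\<lambda>n. 1 - e \<le> X j n) sequentially"
          using eventually_ge_at_top[of "N + j"] 
        proof eventually_elim
          case (elim n)
          show ?case using lower[of "n - N"] elim by simp
        qed
      qed simp
      thus ?case using upper by (simp add: X_def)
    qed
  qed
  have "(\<lambda>j. lim (X j)) \<longlonglongrightarrow> 1"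
  proof (rule order_tendstoI)
    fix c :: real assume "c < 1"
    define e where "e = min ((1 - c) / 2) (1 / 2)"
    have e: "0 < e" "e < 1" "c < 1 - e" using \<open>c < 1\<close> by (auto simp: e_def min_def field_simps)
    show "eventually (\<lambda>j. c < lim (X j)) sequentially"
      using near[OF e(1,2)] by eventually_elim (use e in auto)
  next
    fix c :: real assume "1 < c"
    have near_half: "eventually (\<lambda>j. 1 - 1 / 2 \<le> lim (X j) \<and> lim (X j) \<le> 1) sequentially" by (rule near) auto
    show "eventually (\<lambda>j. lim (X j) < c) sequentially"
      using near_half by eventually_elim (use \<open>1 < c\<close> in auto)
  qed
  thus ?thesis using disc unfolding thin_sequence_def X_def[abs_def] by simp
qed

lemma carleson_const_tendsto_1_of_thin:
  assumes "thin_sequence a" "(\<lambda>n. norm (\<Theta> (a n))) \<longlonglongrightarrow> 0"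
  shows "(\<lambda>N. carleson_const \<Theta> (sigma_measure \<Theta> a N)) \<longlonglongrightarrow> 1"
proof (rule order_tendstoI)
  fix c :: ennreal assume c: "c < 1"
  show "eventually (\<lambda>N. c < carleson_const \<Theta> (sigma_measure \<Theta> a N)) sequentially"
    using eventually_ge_at_top[of 1]
    by eventually_elim (use c one_le_reproducing_const reproducing_const_le_carleson_const in \<open>meson less_le_trans\<close>)
next
  fix c :: ennreal assume "1 < c"
  then obtain d where d: "1 < d" "d < c" using dense by blast
  hence "d < top" by (auto intro: less_le_trans)
  then obtain \<tau> where \<tau>: "d = ennreal \<tau>" "0 \<le> \<tau>" by (cases d) auto
  have "ennreal 1 < ennreal \<tau>" using d(1) \<tau> by simp
  hence "1 < \<tau>" by (subst (asm) ennreal_less_iff) auto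
  from carleson_const_le_of_thin[OF assms this]
  show "eventually (\<lambda>N. carleson_const \<Theta> (sigma_measure \<Theta> a N) < c) sequentially"
    by eventually_elim (use d \<tau> in \<open>meson le_less_trans\<close>)
qed

lemma reproducing_const_tendsto_1_of_carleson:
  assumes "(\<lambda>N. carleson_const \<Theta> (sigma_measure \<Theta> a N)) \<longlonglongrightarrow> 1"
  shows "(\<lambda>N. reproducing_const \<Theta> (sigma_measure \<Theta> a N)) \<longlonglongrightarrow> 1"
proof (rule tendsto_sandwich[OF _ _ tendsto_const assms])
  show "eventually (\<lambda>N. 1 \<le> reproducing_const \<Theta> (sigma_measure \<Theta> a N)) sequentially"
    using eventually_ge_at_top[of 1] by eventually_elim (rule one_le_reproducing_const)
  show "eventually (\<lambda>N. reproducing_const \<Theta> (sigma_measure \<Theta> a N) \<le> carleson_const \<Theta> (sigma_measure \<Theta> a N)) sequentially"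
    using eventually_ge_at_top[of 1] by eventually_elim (rule reproducing_const_le_carleson_const)
qed

end

theorem theorem3p7:
  fixes a :: "nat \<Rightarrow> complex" and \<Theta> :: "complex \<Rightarrow> complex"
  assumes "\<forall>n\<ge>1. a n \<in> ball 0 1"
    and "inner_function \<Theta>"
    and "\<not> \<Theta> constant_on ball 0 1"
    and "(\<lambda>m. SUP n\<in>{m..}. norm (\<Theta> (a n))) \<longlonglongrightarrow> 0"
  shows "(\<forall>N>1. sigma_measure \<Theta> a N =
            point_masses (\<lambda>k. (1 - (norm (a k))\<^sup>2) / (1 - (norm (\<Theta> (a k)))\<^sup>2)) a N) \<and>
         (thin_sequence a \<longleftrightarrow> (\<lambda>N. carleson_const \<Theta> (sigma_measure \<Theta> a N)) \<longlonglongrightarrow> 1) \<and>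
         (thin_sequence a \<longleftrightarrow> (\<lambda>N. reproducing_const \<Theta> (sigma_measure \<Theta> a N)) \<longlonglongrightarrow> 1)"
proof -
  have disc: "\<And>n. 1 \<le> n \<Longrightarrow> norm (a n) < 1" using assms(1) by simp
  note A = disc assms(2,3)
  have small: "(\<lambda>n. norm (\<Theta> (a n))) \<longlonglongrightarrow> 0"
  proof (rule tendsto_sandwich[OF _ _ tendsto_const assms(4)])
    show "eventually (\<lambda>m. norm (\<Theta> (a m)) \<le> (SUP n\<in>{m..}. norm (\<Theta> (a n)))) sequentially"
      using eventually_ge_at_top[of 1]
    proof eventually_elim
      case (elim m)
      have "bdd_above ((\<lambda>n. norm (\<Theta> (a n))) ` {m..})"
        using elim less_imp_le[OF inner_function_norm_less_1[OF assms(2,3) disc]] by (intro bdd_aboveI[of _ 1]) auto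
      thus ?case by (intro cSUP_upper) auto
    qed
  qed auto
  show ?thesis
    using sigma_measure_eq[OF A] carleson_const_tendsto_1_of_thin[OF A _ small]
      reproducing_const_tendsto_1_of_carleson[OF A] thin_of_reproducing_const[OF A] by auto
qed

end
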